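(* Let $\mathbf{y}^{(r)}_{\mathbf{a}_{\mathrm{s}}^1}$ be the optimal first-order moments associated with an optimal solution of the $r$-th relaxation of the scaled problem (S), and set $\tilde{a}_e=\frac{y^{(r)}_{a_{\mathrm{s},e}^1}+1}{2}\frac{\overline{w}}{\rho_e\ell_e}$ for $e\in\{1,\dots,n_{\mathrm{e}}\}$. Suppose that $\inf_{\delta>0}c_j(\delta\tilde{\mathbf{a}})<\overline{c}_j$ for all $j\in\{1,\dots,n_{\mathrm{lc}}\}$, that the weight minimization problem (P) is solvable, and let $\delta^*\tilde{\mathbf{a}}$, with $\delta^*$ a solution of the univariate problem $(\mathrm{U}_{\tilde{\mathbf{a}}})$, be the resulting feasible (upper-bound) solution to (P). Then $$(\delta^*-1)\,0.5\,\overline{w}\,\bigl(n_{\mathrm{e}}+\mathbf{1}^{\mathrm{T}}\mathbf{y}^{(r)}_{\mathbf{a}_{\mathrm{s}}^1}\bigr)\le\varepsilon$$ is a sufficient condition of global $\varepsilon$-optimality of $\delta^*\tilde{\mathbf{a}}$ for (P).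
   Context: Global $\varepsilon$-optimality of a feasible point means that its objective value exceeds the globally optimal value by at most $\varepsilon$. Let $n_{\mathrm{e}}, n_{\mathrm{lc}}$ be positive integers and, for each $j\in\{1,\dots,n_{\mathrm{lc}}\}$, let $n_{\mathrm{dof},j}$ be a positive integer, $\mathbf{0}\neq\mathbf{f}_j\in\mathbb{R}^{n_{\mathrm{dof},j}}$ and $\overline{c}_j>0$. Let $\rho_e,\ell_e>0$ for $e\in\{1,\dots,n_{\mathrm{e}}\}$. For $\mathbf{a}\in\mathbb{R}^{n_{\mathrm{e}}}_{\ge 0}$ the stiffness matrix is $$\mathbf{K}_j(\mathbf{a})=\mathbf{K}_{j,0}+\sum_{e=1}^{n_{\mathrm{e}}}\sum_{i=1}^{3}\mathbf{K}^{(i)}_{j,e}a_e^i,$$ where $\mathbf{K}_{j,0}$ and $\mathbf{K}^{(i)}_{j,e}$ are fixed real symmetric positive semidefinite $n_{\mathrm{dof},j}\times n_{\mathrm{dof},j}$ matrices. Standing assumption: $\mathbf{K}_j(\mathbf{a})\succ 0$ for all $\mathbf{a}>\mathbf{0}$ (componentwise) and all $j$. The compliance is $c_j(\mathbf{a})=\mathbf{f}_j^{\mathrm{T}}\mathbf{K}_j(\mathbf{a})^{\dagger}\mathbf{f}_j$ ($\dagger$ is the Moore-Penrose pseudo-inverse), defined for $\mathbf{a}\ge\mathbf{0}$ with $\mathbf{f}_j\in\mathrm{Im}(\mathbf{K}_j(\mathbf{a}))$. Weight minimization problem: $$\text{(P)}\quad \min_{\mathbf{a},\mathbf{u}}\ \sum_{e=1}^{n_{\mathrm{e}}}\rho_e\ell_e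 a_e\quad\text{s.t.}\quad\mathbf{K}_j(\mathbf{a})\mathbf{u}_j=\mathbf{f}_j,\ \ \overline{c}_j-\mathbf{f}_j^{\mathrm{T}}\mathbf{u}_j\ge 0\ \ \forall j,\quad \mathbf{a}\ge\mathbf{0}.$$ A vector $\mathbf{a}$ is called feasible for (P) if it is feasible together with some $\mathbf{u}_1,\dots,\mathbf{u}_{n_{\mathrm{lc}}}$; equivalently, $\mathbf{a}\ge\mathbf{0}$ and $\begin{pmatrix}\overline{c}_j&-\mathbf{f}_j^{\mathrm{T}}\\-\mathbf{f}_j&\mathbf{K}_j(\mathbf{a})\end{pmatrix}\succeq 0$ for all $j$. Univariate problem: for $\hat{\mathbf{a}}\ge\mathbf{0}$ with $\mathbf{f}_j\in\mathrm{Im}(\mathbf{K}_j(\hat{\mathbf{a}}))$ for all $j$, $$(\mathrm{U}_{\hat{\mathbf{a}}})\quad\min_{\delta}\ \delta\quad\text{s.t.}\quad\mathbf{f}_j^{\mathrm{T}}\mathbf{K}_j(\delta\hat{\mathbf{a}})^{\dagger}\mathbf{f}_j\le\overline{c}_j\ \ \forall j,\quad\delta>0.$$ Scaled problem: fix any $\hat{\mathbf{a}}>\mathbf{0}$, let $\hat\delta$ be a solution of $(\mathrm{U}_{\hat{\mathbf{a}}})$ and put $\overline{w}=\hat\delta\sum_e\rho_e\ell_e\hat a_e$ (an upper bound on the optimal weight). Substituting $a_e=\frac{a_{\mathrm{s},e}+1}{2}\frac{\overline{w}}{\rho_e\ell_e}$ and writing $\mathbf{K}_j(\mathbf{a}_{\mathrm{s}})$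 for the resulting polynomial matrix, define $$\text{(S)}\quad\min_{\mathbf{a}_{\mathrm{s}}}\ 0.5\,\overline{w}\,(n_{\mathrm{e}}+\mathbf{1}^{\mathrm{T}}\mathbf{a}_{\mathrm{s}})\quad\text{s.t.}\quad\begin{pmatrix}\overline{c}_j&-\mathbf{f}_j^{\mathrm{T}}\\-\mathbf{f}_j&\mathbf{K}_j(\mathbf{a}_{\mathrm{s}})\end{pmatrix}\succeq 0\ \ \forall j,\quad a_{\mathrm{s},e}^2\le 1\ \ \forall e.$$ Moment relaxations (Lasserre hierarchy): write all constraints of (S) as $\mathbf{G}(\mathbf{a}_{\mathrm{s}})\succeq 0$ with $\mathbf{G}$ block-diagonal (blocks: the matrix constraints and the scalars $1-a_{\mathrm{s},e}^2$), and let $d$ be the maximum degree of a polynomial in $\mathbf{G}$. Let $\mathbf{b}_k$ be the column vector of all monomials in $\mathbf{a}_{\mathrm{s}}$ of degree at most $k$. For a vector $\mathbf{y}$ of moments indexed by the monomials in $\mathbf{b}_{2r}$, with the moment of the monomial $1$ equal to $1$, let $L_{\mathbf{y}}$ be the linear map sending each monomial to its moment, applied entrywise to polynomial matrices. For $2r\ge d$ the $r$-th relaxation is $$f^{(r)}=\min_{\mathbf{y}}\ L_{\mathbf{y}}\bigl(0.5\,\overline{w}(n_{\mathrm{e}}+\mathbf{1}^{\mathrm{T}}\mathbf{a}_{\mathrm{s}})\bigr)\quad\text{s.t.}\quad\mathbf{M}_{2r}(\mathbf{y})=L_{\mathbf{y}}(\mathbf{b}_r\mathbf{b}_r^{\mathrm{T}})\succeq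 0,\quad\mathbf{M}_{2r-d}(\mathbf{G}\mathbf{y})=L_{\mathbf{y}}\bigl((\mathbf{b}_s\mathbf{b}_s^{\mathrm{T}})\otimes\mathbf{G}\bigr)\succeq 0,\quad s=\lfloor(2r-d)/2\rfloor.$$ The first-order moments are the entries $y_{a_{\mathrm{s},e}^1}$ of $\mathbf{y}$ corresponding to the degree-one monomials $a_{\mathrm{s},e}$. *)

theory Defs
  imports "Jordan_Normal_Form.Matrix" "HOL-Library.Poly_Mapping" Complex_Main
begin

section \<open>Matrices\<close>

definition pos_semidef :: "real mat \<Rightarrow> bool" where
  "pos_semidef A \<longleftrightarrow> square_mat A \<and> transpose_mat A = A \<and>
     (\<forall>v \<in> carrier_vec (dim_row A). v \<bullet> (A *\<^sub>v v) \<ge> 0)"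

definition pos_def :: "real mat \<Rightarrow> bool" where
  "pos_def A \<longleftrightarrow> square_mat A \<and> transpose_mat A = A \<and>
     (\<forall>v \<in> carrier_vec (dim_row A). v \<noteq> 0\<^sub>v (dim_row A) \<longrightarrow> v \<bullet> (A *\<^sub>v v) > 0)"

text \<open>The four Penrose conditions; they have exactly one solution for every real matrix.\<close>

definition is_pseudo_inverse :: "real mat \<Rightarrow> real mat \<Rightarrow> bool" where
  "is_pseudo_inverse A X \<longleftrightarrow> X \<in> carrier_mat (dim_col A) (dim_row A) \<and>
     A * X * A = A \<and> X * A * X = X \<and>
     transpose_mat (A * X) = A * X \<and> transpose_mat (X * A) = X * A"

definition pseudo_inverse :: "real mat \<Rightarrow> real mat" where
  "pseudo_inverse A = (THE X. is_pseudo_inverse A X)"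

definition kronecker :: "'a::times mat \<Rightarrow> 'a mat \<Rightarrow> 'a mat" where
  "kronecker A B = mat (dim_row A * dim_row B) (dim_col A * dim_col B)
     (\<lambda>(i, j). A $$ (i div dim_row B, j div dim_col B) * B $$ (i mod dim_row B, j mod dim_col B))"

definition outer_square :: "'a::times vec \<Rightarrow> 'a mat" where
  "outer_square v = mat (dim_vec v) (dim_vec v) (\<lambda>(i, j). v $ i * v $ j)"


section \<open>Multivariate polynomials\<close>

text \<open>A monomial is its finitely supported exponent vector, a polynomial a finitely supported
  function from monomials to coefficients; products of polynomials are convolutions.\<close>

type_synonym monomial = "nat \<Rightarrow>\<^sub>0 nat"
type_synonym mpoly = "monomial \<Rightarrow>\<^sub>0 real"

definition mono_of_var :: "nat \<Rightarrow> monomial" where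
  "mono_of_var e = Poly_Mapping.single e 1"

definition mpoly_const :: "real \<Rightarrow> mpoly" where
  "mpoly_const c = Poly_Mapping.single 0 c"

definition mpoly_monom :: "monomial \<Rightarrow> mpoly" where
  "mpoly_monom m = Poly_Mapping.single m 1"

definition mpoly_var :: "nat \<Rightarrow> mpoly" where
  "mpoly_var e = mpoly_monom (mono_of_var e)"

definition monomial_degree :: "monomial \<Rightarrow> nat" where
  "monomial_degree m = (\<Sum>i\<in>Poly_Mapping.keys m. Poly_Mapping.lookup m i)"

definition total_degree :: "mpoly \<Rightarrow> nat" where
  "total_degree p = Max (insert 0 (monomial_degree ` Poly_Mapping.keys p))"

definition max_degree :: "mpoly mat \<Rightarrow> nat" where
  "max_degree G = Max (insert 0 (total_degree ` elements_mat G))"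

text \<open>The vector of all monomials of degree at most k in the variables \<open>0, \<dots>, n - 1\<close>, enumerated
  along the library's linear order on exponent vectors (any enumeration would do).\<close>

definition monomials_upto :: "nat \<Rightarrow> nat \<Rightarrow> monomial set" where
  "monomials_upto n k = {m. Poly_Mapping.keys m \<subseteq> {..<n} \<and> monomial_degree m \<le> k}"

definition monomial_vec :: "nat \<Rightarrow> nat \<Rightarrow> mpoly vec" where
  "monomial_vec n k = vec_of_list (map mpoly_monom (sorted_list_of_set (monomials_upto n k)))"

definition riesz :: "(monomial \<Rightarrow> real) \<Rightarrow> mpoly \<Rightarrow> real" where
  "riesz y p = (\<Sum>m\<in>Poly_Mapping.keys p. Poly_Mapping.lookup p m * y m)"


section \<open>The weight minimization problem\<close>

text \<open>Elements, load cases and degrees of freedom are numbered from 0; the powers of the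
  cross-section variables are numbered 1, 2, 3.  Thus \<open>Kpow P j e i\<close> multiplies the i-th power
  of variable e in the stiffness matrix of load case j.\<close>

record design_problem =
  n_el :: nat
  n_lc :: nat
  n_dof :: "nat \<Rightarrow> nat"
  force :: "nat \<Rightarrow> real vec"
  c_bar :: "nat \<Rightarrow> real"
  rho :: "nat \<Rightarrow> real"
  len :: "nat \<Rightarrow> real"
  Kzero :: "nat \<Rightarrow> real mat"
  Kpow :: "nat \<Rightarrow> nat \<Rightarrow> nat \<Rightarrow> real mat"

text \<open>The stiffness matrix over any commutative ring into which the reals are mapped by \<open>emb\<close>:
  used with the identity for numerical designs and with \<open>mpoly_const\<close> for polynomial matrices.\<close>

definition stiffness_gen ::
  "(real \<Rightarrow> 'a::comm_ring_1) \<Rightarrow> design_problem \<Rightarrow> nat \<Rightarrow> 'a vec \<Rightarrow> 'a mat" where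
  "stiffness_gen emb P j a = mat (n_dof P j) (n_dof P j) (\<lambda>pq.
     emb (Kzero P j $$ pq) + (\<Sum>e<n_el P. \<Sum>i=1..3. emb (Kpow P j e i $$ pq) * (a $ e) ^ i))"

definition stiffness :: "design_problem \<Rightarrow> nat \<Rightarrow> real vec \<Rightarrow> real mat" where
  "stiffness = stiffness_gen (\<lambda>x. x)"

definition valid_problem :: "design_problem \<Rightarrow> bool" where
  "valid_problem P \<longleftrightarrow>
     n_el P > 0 \<and> n_lc P > 0 \<and>
     (\<forall>e < n_el P. rho P e > 0 \<and> len P e > 0) \<and>
     (\<forall>j < n_lc P.
        n_dof P j > 0 \<and>
        force P j \<in> carrier_vec (n_dof P j) \<and> force P j \<noteq> 0\<^sub>v (n_dof P j) \<and>
        c_bar P j > 0 \<and>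
        Kzero P j \<in> carrier_mat (n_dof P j) (n_dof P j) \<and> pos_semidef (Kzero P j) \<and>
        (\<forall>e < n_el P. \<forall>i \<in> {1..3}.
           Kpow P j e i \<in> carrier_mat (n_dof P j) (n_dof P j) \<and> pos_semidef (Kpow P j e i)) \<and>
        (\<forall>a \<in> carrier_vec (n_el P). (\<forall>e < n_el P. a $ e > 0) \<longrightarrow> pos_def (stiffness P j a)))"

definition weight :: "design_problem \<Rightarrow> real vec \<Rightarrow> real" where
  "weight P a = (\<Sum>e<n_el P. rho P e * len P e * a $ e)"

definition feasible :: "design_problem \<Rightarrow> real vec \<Rightarrow> bool" where
  "feasible P a \<longleftrightarrow> a \<in> carrier_vec (n_el P) \<and> (\<forall>e < n_el P. a $ e \<ge> 0) \<and>
     (\<exists>u. \<forall>j < n_lc P. u j \<in> carrier_vec (n_dof P j) \<and>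
        stiffness P j a *\<^sub>v u j = force P j \<and> c_bar P j - force P j \<bullet> u j \<ge> 0)"

definition solvable :: "design_problem \<Rightarrow> bool" where
  "solvable P \<longleftrightarrow> (\<exists>a. feasible P a \<and> (\<forall>b. feasible P b \<longrightarrow> weight P a \<le> weight P b))"

definition globally_eps_optimal :: "design_problem \<Rightarrow> real \<Rightarrow> real vec \<Rightarrow> bool" where
  "globally_eps_optimal P \<epsilon> a \<longleftrightarrow>
     feasible P a \<and> weight P a \<le> (INF b \<in> Collect (feasible P). weight P b) + \<epsilon>"


section \<open>The univariate problem\<close>

text \<open>Total through the pseudo-inverse, but the compliance of \<open>a\<close> only if \<open>a\<close> is nonnegative and
  the force lies in the range of the stiffness matrix.  This is automatic for positive \<open>a\<close>, and
  also for the design read off from the first-order moments of a feasible point of a relaxation: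
  if variable e has first moment -1, the constraints force the moments of the square and, when
  it occurs, the cube of that design variable to vanish.\<close>

definition compliance :: "design_problem \<Rightarrow> nat \<Rightarrow> real vec \<Rightarrow> real" where
  "compliance P j a = force P j \<bullet> (pseudo_inverse (stiffness P j a) *\<^sub>v force P j)"

definition univariate_feasible :: "design_problem \<Rightarrow> real vec \<Rightarrow> real \<Rightarrow> bool" where
  "univariate_feasible P a \<delta> \<longleftrightarrow>
     (\<forall>j < n_lc P. compliance P j (\<delta> \<cdot>\<^sub>v a) \<le> c_bar P j) \<and> \<delta> > 0"

definition univariate_solution :: "design_problem \<Rightarrow> real vec \<Rightarrow> real \<Rightarrow> bool" where
  "univariate_solution P a \<delta> \<longleftrightarrow>
     univariate_feasible P a \<delta> \<and> (\<forall>\<delta>'. univariate_feasible P a \<delta>' \<longrightarrow> \<delta> \<le> \<delta>')"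


section \<open>The scaled problem and its moment relaxations\<close>

definition unscale_poly :: "design_problem \<Rightarrow> real \<Rightarrow> mpoly vec" where
  "unscale_poly P w = vec (n_el P)
     (\<lambda>e. (mpoly_var e + 1) * mpoly_const (1 / 2 * (w / (rho P e * len P e))))"

definition scaled_stiffness :: "design_problem \<Rightarrow> real \<Rightarrow> nat \<Rightarrow> mpoly mat" where
  "scaled_stiffness P w j = stiffness_gen mpoly_const P j (unscale_poly P w)"

definition compliance_block :: "design_problem \<Rightarrow> real \<Rightarrow> nat \<Rightarrow> mpoly mat" where
  "compliance_block P w j =
     (let f = mat_of_row (map_vec mpoly_const (force P j)) in
      four_block_mat (mat 1 1 (\<lambda>_. mpoly_const (c_bar P j))) (- f)
        (- transpose_mat f) (scaled_stiffness P w j))"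

definition constraint_matrix :: "design_problem \<Rightarrow> real \<Rightarrow> mpoly mat" where
  "constraint_matrix P w = diag_block_mat
     (map (compliance_block P w) [0..<n_lc P] @
      map (\<lambda>e. mat 1 1 (\<lambda>_. 1 - mpoly_var e ^ 2)) [0..<n_el P])"

definition scaled_objective :: "design_problem \<Rightarrow> real \<Rightarrow> mpoly" where
  "scaled_objective P w =
     mpoly_const (0.5 * w) * (of_nat (n_el P) + (\<Sum>e<n_el P. mpoly_var e))"

text \<open>A moment vector is a function on all monomials, of which only the values at monomials of
  degree at most 2r are ever used.\<close>

definition relaxation_feasible ::
  "design_problem \<Rightarrow> real \<Rightarrow> nat \<Rightarrow> (monomial \<Rightarrow> real) \<Rightarrow> bool" where
  "relaxation_feasible P w r y \<longleftrightarrow>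
     (let G = constraint_matrix P w; s = (2 * r - max_degree G) div 2 in
      y 0 = 1 \<and>
      pos_semidef (map_mat (riesz y) (outer_square (monomial_vec (n_el P) r))) \<and>
      pos_semidef (map_mat (riesz y) (kronecker (outer_square (monomial_vec (n_el P) s)) G)))"

definition relaxation_solution ::
  "design_problem \<Rightarrow> real \<Rightarrow> nat \<Rightarrow> (monomial \<Rightarrow> real) \<Rightarrow> bool" where
  "relaxation_solution P w r y \<longleftrightarrow>
     relaxation_feasible P w r y \<and>
     (\<forall>z. relaxation_feasible P w r z \<longrightarrow>
        riesz y (scaled_objective P w) \<le> riesz z (scaled_objective P w))"

definition moment_design :: "design_problem \<Rightarrow> real \<Rightarrow> (monomial \<Rightarrow> real) \<Rightarrow> real vec" where
  "moment_design P w y =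
     vec (n_el P) (\<lambda>e. (y (mono_of_var e) + 1) / 2 * (w / (rho P e * len P e)))"

end

theory Submission
  imports Defs
begin

text \<open>The optimal value of a relaxation is the weight of the design read off from its first-order
  moments, and it bounds the optimal weight of (P) from below because evaluation at a scaled feasible
  design of weight at most \<open>w_bar\<close> is a feasible moment vector; scaling the moment design
  by \<open>\<delta>_star\<close> multiplies its weight by \<open>\<delta>_star\<close>.  The remaining
  point is that the force lies in the range of the stiffness matrix of the moment design, even if some
  of its cross sections vanish.  For such an element the constraints force the moments of the square and,
  where it occurs, the cube of the design variable to vanish, so every kernel vector \<open>v\<close> of that
  stiffness matrix has \<open>v\<^sup>T L(K) v = 0\<close>
  for the linearized stiffness matrix \<open>L(K)\<close>, and positive semidefiniteness of the compliance
  block makes \<open>v\<close> orthogonal to the force.\<close>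

section \<open>Positive semidefinite matrices\<close>

text \<open>Let L be the Riesz functional of an optimal \<open>y\<close> and z = x_e + 1, so that
  the cross section e of the moment design is a positive multiple of L(z). The moment matrix gives
  L(z^2) >= 0 and the box constraint gives L(x_e^2) <= 1, hence L(z^2) <= 2 L(z). So L(z) >= 0, and
  L(z) = 0 forces L(z^2) = 0. Then L(z^3) = 0 by Cauchy-Schwarz, L(z^3)^2 <= L(z^2) L(z^4), for
  which z^2 must have degree at most r. This is why the degree of the constraint matrix is
  estimated: a nonzero cubic stiffness term makes it at least 3, and 2r >= 3 means r >= 2. The range
  condition matters because \<open>compliance\<close> is total: for a force outside the range, the
  pseudo-inverse solves the equilibrium equation only for the projection of the force, and a bound
  on \<open>compliance\<close> does not give feasibility.\<close>

lemma quadratic_form_sum: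
  fixes A :: "real mat"
  assumes "A \<in> carrier_mat n n" "v \<in> carrier_vec n"
  shows "v \<bullet> (A *\<^sub>v v) = (\<Sum>i<n. \<Sum>j<n. A $$ (i, j) * (v $ i * v $ j))"
proof -
  have "v \<bullet> (A *\<^sub>v v) = (\<Sum>i<n. v $ i * (\<Sum>j<n. A $$ (i, j) * v $ j))"
    using assms by (simp add: scalar_prod_def atLeast0LessThan)
  then show ?thesis
    by (simp add: sum_distrib_left mult_ac)
qed

lemma symmetric_mat_iff:
  assumes "A \<in> carrier_mat n n"
  shows "transpose_mat A = A \<longleftrightarrow> (\<forall>i<n. \<forall>j<n. A $$ (i, j) = A $$ (j, i))"
proof
  assume "transpose_mat A = A"
  then show "\<forall>i<n. \<forall>j<n. A $$ (i, j) = A $$ (j, i)"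
    using assms by (metis carrier_matD index_transpose_mat(1))
qed (use assms in \<open>auto intro!: eq_matI\<close>)

lemma pos_semidef_iff:
  assumes "A \<in> carrier_mat n n"
  shows "pos_semidef A \<longleftrightarrow> (\<forall>i<n. \<forall>j<n. A $$ (i, j) = A $$ (j, i)) \<and>
    (\<forall>v \<in> carrier_vec n. v \<bullet> (A *\<^sub>v v) \<ge> 0)"
  using assms symmetric_mat_iff[OF assms] by (auto simp: pos_semidef_def)

text \<open>This is C^T A C, where column i of C has the single entry \<open>c i\<close>, in row
  \<open>g i\<close>. As \<open>g\<close> may repeat indices, one statement covers principal
  submatrices, rank-one matrices (n = 1) and Kronecker products of a rank-one matrix with A.\<close>

lemma pos_semidef_congruence:
  fixes A :: "real mat"
  assumes A: "A \<in> carrier_mat n n" and "pos_semidef A" and g: "\<And>i. i < m \<Longrightarrow> g i < n"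
  shows "pos_semidef (mat m m (\<lambda>(i, j). A $$ (g i, g j) * (c i * c j)))" (is "pos_semidef ?B")
proof -
  have "z \<bullet> (?B *\<^sub>v z) \<ge> 0" if z: "z \<in> carrier_vec m" for z
  proof -
    \<comment> \<open>The vector C z; several i may contribute to the same entry.\<close>
    define w where "w = vec n (\<lambda>p. \<Sum>i<m. if g i = p then c i * z $ i else 0)"
    have w: "(\<Sum>p<n. F p * w $ p) = (\<Sum>i<m. F (g i) * (c i * z $ i))" for F
    proof -
      have "(\<Sum>p<n. F p * w $ p) = (\<Sum>p<n. \<Sum>i<m. if g i = p then F p * (c i * z $ i) else 0)"
        by (simp add: w_def sum_distrib_left if_distrib cong: if_cong)
      also have "\<dots> = (\<Sum>i<m. \<Sum>p<n. if g i = p then F p * (c i * z $ i) else 0)"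
        by (rule sum.swap)
      also have "\<dots> = (\<Sum>i<m. F (g i) * (c i * z $ i))"
        by (rule sum.cong) (use g in auto)
      finally show ?thesis .
    qed
    have wc: "w \<in> carrier_vec n"
      by (simp add: w_def)
    have "z \<bullet> (?B *\<^sub>v z) = (\<Sum>i<m. (\<Sum>j<m. A $$ (g i, g j) * (c j * z $ j)) * (c i * z $ i))"
      by (subst quadratic_form_sum[OF _ z]) (auto simp: sum_distrib_left sum_distrib_right mult_ac intro!: sum.cong)
    also have "\<dots> = (\<Sum>i<m. (\<Sum>q<n. A $$ (g i, q) * w $ q) * (c i * z $ i))"
      by (simp add: w)
    also have "\<dots> = (\<Sum>p<n. (\<Sum>q<n. A $$ (p, q) * w $ q) * w $ p)"
      by (rule w[symmetric])
    also have "\<dots> = w \<bullet> (A *\<^sub>v w)"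
      by (subst quadratic_form_sum[OF A wc]) (simp add: sum_distrib_left sum_distrib_right mult_ac)
    also have "\<dots> \<ge> 0"
      using assms wc by (simp add: pos_semidef_iff[OF A])
    finally show ?thesis .
  qed
  then show ?thesis
    using assms by (auto simp: pos_semidef_iff[of _ m] pos_semidef_iff[OF A])
qed

lemma pos_semidef_submatrix:
  assumes "A \<in> carrier_mat n n" "pos_semidef A" "B \<in> carrier_mat m m"
    and "\<And>i. i < m \<Longrightarrow> g i < n" "\<And>i j. i < m \<Longrightarrow> j < m \<Longrightarrow> B $$ (i, j) = A $$ (g i, g j)"
  shows "pos_semidef B"
proof -
  have "B = mat m m (\<lambda>(i, j). A $$ (g i, g j) * (1 * 1))"
    using assms by (intro eq_matI) auto
  then show ?thesis
    using pos_semidef_congruence[OF assms(1,2), of m g "\<lambda>_. 1"] assms(4) by simp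
qed

lemma pos_semidef_1x1: "pos_semidef (mat 1 1 (\<lambda>_. x)) \<longleftrightarrow> x \<ge> 0"
proof
  assume "pos_semidef (mat 1 1 (\<lambda>_. x))"
  then have "vec 1 (\<lambda>_. 1) \<bullet> (mat 1 1 (\<lambda>_. x) *\<^sub>v vec 1 (\<lambda>_. 1)) \<ge> 0"
    by (auto simp: pos_semidef_def)
  then show "x \<ge> 0"
    by (subst (asm) quadratic_form_sum[of _ 1]) auto
next
  assume "x \<ge> 0"
  then show "pos_semidef (mat 1 1 (\<lambda>_. x))"
    by (auto simp: pos_semidef_iff[of _ 1] quadratic_form_sum[of _ 1])
qed

lemma pos_semidef_diag_four_block:
  fixes A D :: "real mat"
  assumes A: "A \<in> carrier_mat n n" "pos_semidef A" and D: "D \<in> carrier_mat m m" "pos_semidef D"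
  shows "pos_semidef (four_block_mat A (0\<^sub>m n m) (0\<^sub>m m n) D)" (is "pos_semidef ?B")
proof -
  have "v \<bullet> (?B *\<^sub>v v) \<ge> 0" if v: "v \<in> carrier_vec (n + m)" for v
  proof -
    define a d where "a = vec_first v n" and "d = vec_last v m"
    have c: "a \<in> carrier_vec n" "d \<in> carrier_vec m"
      by (auto simp: a_def d_def)
    have v: "v = a @\<^sub>v d"
      using v by (simp add: a_def d_def)
    have "?B *\<^sub>v v = (A *\<^sub>v a) @\<^sub>v (D *\<^sub>v d)"
      unfolding v by (subst four_block_mat_mult_vec[OF A(1) _ _ D(1) c]) (use A D c in auto)
    then have "v \<bullet> (?B *\<^sub>v v) = a \<bullet> (A *\<^sub>v a) + d \<bullet> (D *\<^sub>v d)"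
      unfolding v using A D c by (metis scalar_prod_append mult_mat_vec_carrier)
    then show ?thesis
      using A D c by (auto simp: pos_semidef_iff)
  qed
  moreover have "?B $$ (i, j) = ?B $$ (j, i)" if "i < n + m" "j < n + m" for i j
    using that A D by (auto simp: pos_semidef_iff[OF A(1)] pos_semidef_iff[OF D(1)])
  ultimately show ?thesis
    using A D by (subst pos_semidef_iff[of _ "n + m"]) auto
qed

lemma pos_semidef_diag_block_mat:
  assumes "\<And>A. A \<in> set As \<Longrightarrow> pos_semidef A"
  shows "pos_semidef (diag_block_mat As)"
  using assms
proof (induction As)
  case Nil
  then show ?case
    by (simp add: pos_semidef_def scalar_prod_def)
next
  case (Cons A As)
  let ?D = "diag_block_mat As"
  have psd: "pos_semidef A" "pos_semidef ?D"
    using Cons by auto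
  then have sq: "dim_col A = dim_row A" "dim_col ?D = dim_row ?D"
    by (auto simp: pos_semidef_def)
  have "pos_semidef (four_block_mat A (0\<^sub>m (dim_row A) (dim_row ?D)) (0\<^sub>m (dim_row ?D) (dim_row A)) ?D)"
    by (rule pos_semidef_diag_four_block) (use psd sq in \<open>auto intro: carrier_matI\<close>)
  then show ?case
    by (simp add: Let_def sq)
qed

text \<open>Squareness of the blocks makes the row offset and the column offset of a block equal, so
  that the block is a principal submatrix.\<close>

lemma diag_block_mat_offset:
  assumes "B \<in> set As" "\<And>A. A \<in> set As \<Longrightarrow> square_mat A"
  shows "\<exists>k. k + dim_row B \<le> dim_row (diag_block_mat As) \<and>
    (\<forall>i < dim_row B. \<forall>j < dim_row B. diag_block_mat As $$ (k + i, k + j) = B $$ (i, j))"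
  using assms
proof (induction As)
  case (Cons A As)
  let ?D = "diag_block_mat As"
  have sq: "dim_col A = dim_row A" "dim_col ?D = dim_row ?D"
    using Cons.prems diag_block_mat_square[of As] by auto
  show ?case
  proof (cases "B = A")
    case True
    then show ?thesis
      using sq by (intro exI[of _ 0]) (auto simp: Let_def)
  next
    case False
    then obtain k where k: "k + dim_row B \<le> dim_row ?D"
      "\<And>i j. i < dim_row B \<Longrightarrow> j < dim_row B \<Longrightarrow> ?D $$ (k + i, k + j) = B $$ (i, j)"
      using Cons by auto
    then show ?thesis
      using sq by (intro exI[of _ "dim_row A + k"]) (auto simp: Let_def)
  qed
qed auto

lemma pos_semidef_diag_block_matD:
  assumes "pos_semidef (diag_block_mat As)" "\<And>A. A \<in> set As \<Longrightarrow> square_mat A" "B \<in> set As"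
  shows "pos_semidef B"
proof -
  obtain k where k: "k + dim_row B \<le> dim_row (diag_block_mat As)"
    "\<forall>i < dim_row B. \<forall>j < dim_row B. diag_block_mat As $$ (k + i, k + j) = B $$ (i, j)"
    using diag_block_mat_offset[OF assms(3,2)] by blast
  have "square_mat (diag_block_mat As)"
    using diag_block_mat_square assms(2) by blast
  then show ?thesis
    using k assms by (intro pos_semidef_submatrix[of "diag_block_mat As" "dim_row (diag_block_mat As)" B "dim_row B" "\<lambda>i. k + i"])
      (auto intro: carrier_matI)
qed

lemma map_diag_block_mat:
  assumes "h 0 = 0"
  shows "map_mat h (diag_block_mat As) = diag_block_mat (map (map_mat h) As)"
proof (induction As)
  case Nil
  then show ?case by auto
next
  case (Cons A As)
  let ?D = "diag_block_mat As"
  have "map_mat h (0\<^sub>m a b) = 0\<^sub>m a b" for a b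
    using assms by auto
  then have "map_mat h (diag_block_mat (A # As)) =
    four_block_mat (map_mat h A) (0\<^sub>m (dim_row A) (dim_col ?D)) (0\<^sub>m (dim_row ?D) (dim_col A)) (map_mat h ?D)"
    unfolding diag_block_mat.simps Let_def
    by (subst map_four_block_mat[of A "dim_row A" "dim_col A" _ "dim_col ?D" _ "dim_row ?D"]) (auto intro: carrier_matI)
  also have "\<dots> = diag_block_mat (map (map_mat h) (A # As))"
    unfolding Cons by (simp add: Let_def dim_diag_block_mat comp_def)
  finally show ?case .
qed

section \<open>Orthogonal projection and the range of a symmetric matrix\<close>

lemma scalar_prod_self_eq_0_iff:
  fixes v :: "real vec"
  assumes "v \<in> carrier_vec n"
  shows "v \<bullet> v = 0 \<longleftrightarrow> v = 0\<^sub>v n"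
proof
  assume "v \<bullet> v = 0"
  then have "v $ i = 0" if "i < n" for i
    using assms that by (auto simp: scalar_prod_def sum_nonneg_eq_0_iff)
  then show "v = 0\<^sub>v n"
    using assms by (intro eq_vecI) auto
qed simp

lemma vec_diff_add_cancel:
  fixes x :: "'a::ab_group_add vec"
  assumes "x \<in> carrier_vec n" "y \<in> carrier_vec n"
  shows "x - y + y = x"
  using assms by (intro eq_vecI) auto

text \<open>Gram-Schmidt, one column at a time. The second conjunct expresses, without spans, that
  the projection lies in the span of the first k columns. The vector \<open>f\<close> varies in the
  induction because the hypothesis is applied both to \<open>f\<close> and to the next
  column.\<close>

lemma orthogonal_projection_on_columns:
  fixes A :: "real mat"
  assumes A: "A \<in> carrier_mat n m" and f: "f \<in> carrier_vec n" and "k \<le> m"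
  shows "\<exists>u \<in> carrier_vec m. (\<forall>i<k. col A i \<bullet> (f - A *\<^sub>v u) = 0) \<and>
    (\<forall>h \<in> carrier_vec n. (\<forall>i<k. col A i \<bullet> h = 0) \<longrightarrow> (A *\<^sub>v u) \<bullet> h = 0)"
  using f \<open>k \<le> m\<close>
proof (induction k arbitrary: f)
  case 0
  have "A *\<^sub>v 0\<^sub>v m = 0\<^sub>v n"
    using A by auto
  then show ?case
    by (intro bexI[of _ "0\<^sub>v m"]) auto
next
  case (Suc k)
  define c where "c = col A k"
  have k: "k < m" and c: "c \<in> carrier_vec n"
    using Suc.prems A by (auto simp: c_def)
  have col: "col A i \<in> carrier_vec n" for i
    using A by auto
  have Ae: "A *\<^sub>v unit_vec m k = c"
    unfolding c_def using A k by (intro eq_vecI) auto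
  obtain u0 where u0: "u0 \<in> carrier_vec m" "\<And>i. i < k \<Longrightarrow> col A i \<bullet> (c - A *\<^sub>v u0) = 0"
    "\<And>h. h \<in> carrier_vec n \<Longrightarrow> \<forall>i<k. col A i \<bullet> h = 0 \<Longrightarrow> (A *\<^sub>v u0) \<bullet> h = 0"
    using Suc.IH[OF c] k by auto
  obtain u where u: "u \<in> carrier_vec m" "\<And>i. i < k \<Longrightarrow> col A i \<bullet> (f - A *\<^sub>v u) = 0"
    "\<And>h. h \<in> carrier_vec n \<Longrightarrow> \<forall>i<k. col A i \<bullet> h = 0 \<Longrightarrow> (A *\<^sub>v u) \<bullet> h = 0"
    using Suc.IH[OF Suc.prems(1)] k by auto
  define h0 where "h0 = c - A *\<^sub>v u0"
  define h where "h = f - A *\<^sub>v u"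
  \<comment> \<open>The residual \<open>h0\<close> of the new column is the new orthogonal
    direction, and \<open>t\<close> is the coefficient of \<open>h\<close> along it. If the column
    depends on the earlier ones then \<open>h0\<close> is zero, division by zero gives
    \<open>t = 0\<close>, and nothing is added.\<close>
  define t where "t = (h0 \<bullet> h) / (h0 \<bullet> h0)"
  define u' where "u' = u + t \<cdot>\<^sub>v (unit_vec m k - u0)"
  define h' where "h' = h - t \<cdot>\<^sub>v h0"
  have Au0: "A *\<^sub>v u0 \<in> carrier_vec n" and Au: "A *\<^sub>v u \<in> carrier_vec n"
    using A u u0 by auto
  have hc: "h \<in> carrier_vec n" "h0 \<in> carrier_vec n" "h' \<in> carrier_vec n"
    using Au0 Au c Suc.prems by (auto simp: h_def h0_def h'_def)
  have u': "u' \<in> carrier_vec m"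
    using u u0 by (auto simp: u'_def)
  have Au': "A *\<^sub>v u' = A *\<^sub>v u + t \<cdot>\<^sub>v (c - A *\<^sub>v u0)"
    unfolding u'_def using A u(1) u0(1)
    by (simp add: mult_add_distrib_mat_vec[of _ n m] mult_mat_vec[of _ n m] mult_minus_distrib_mat_vec[of _ n m] Ae)
  have res: "f - A *\<^sub>v u' = h'"
    unfolding Au' h'_def h_def h0_def using Au Au0 c Suc.prems(1) by (intro eq_vecI) auto
  have perp: "col A i \<bullet> h' = 0" if "i < k" for i
    using u(2)[OF that] u0(2)[OF that] hc col[of i] unfolding h'_def h_def[symmetric] h0_def[symmetric]
    by (simp add: scalar_prod_minus_distrib[of _ n])
  \<comment> \<open>The new column differs from \<open>h0\<close> by a combination of earlier
    columns, to which \<open>h'\<close> is already orthogonal.\<close>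
  have "c \<bullet> h' = (h0 + A *\<^sub>v u0) \<bullet> h'"
    unfolding h0_def using vec_diff_add_cancel[OF c Au0] by simp
  also have "\<dots> = h0 \<bullet> h'"
    using u0(3)[of h'] perp hc Au0 by (simp add: add_scalar_prod_distrib[of _ n])
  also have "\<dots> = 0"
  proof (cases "h0 \<bullet> h0 = 0")
    case True
    then have "h0 = 0\<^sub>v n"
      using scalar_prod_self_eq_0_iff[OF hc(2)] by simp
    then show ?thesis
      using hc by simp
  next
    case False
    then show ?thesis
      using hc by (simp add: h'_def t_def scalar_prod_minus_distrib[of _ n])
  qed
  finally have "col A k \<bullet> h' = 0"
    by (simp add: c_def)
  with perp have "\<forall>i<Suc k. col A i \<bullet> (f - A *\<^sub>v u') = 0"
    unfolding res by (simp add: less_Suc_eq)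
  moreover have "(A *\<^sub>v u') \<bullet> v = 0" if v: "v \<in> carrier_vec n" "\<forall>i<Suc k. col A i \<bullet> v = 0" for v
  proof -
    have "(A *\<^sub>v u) \<bullet> v = 0" "(A *\<^sub>v u0) \<bullet> v = 0" "c \<bullet> v = 0"
      using u(3)[of v] u0(3)[of v] v by (auto simp: c_def)
    then have "(t \<cdot>\<^sub>v (c - A *\<^sub>v u0)) \<bullet> v = 0"
      using minus_scalar_prod_distrib[OF c Au0 v(1)] smult_scalar_prod_distrib[of "c - A *\<^sub>v u0" n v t] c Au0 v(1)
      by (metis minus_carrier_vec diff_0_right mult_zero_right)
    then show ?thesis
      unfolding Au' using add_scalar_prod_distrib[of "A *\<^sub>v u" n "t \<cdot>\<^sub>v (c - A *\<^sub>v u0)" v] \<open>(A *\<^sub>v u) \<bullet> v = 0\<close> Au Au0 c v(1)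
      by (metis minus_carrier_vec smult_carrier_vec add_0_right)
  qed
  ultimately show ?case
    using u' by blast
qed

text \<open>The residual of the projection of \<open>f\<close> on the columns is orthogonal to all
  columns. These are also the rows, so the residual lies in the kernel; being orthogonal to both
  \<open>f\<close> and the projection, it is orthogonal to itself.\<close>

lemma symmetric_range:
  fixes A :: "real mat"
  assumes A: "A \<in> carrier_mat n n" and sym: "transpose_mat A = A" and f: "f \<in> carrier_vec n"
    and ker: "\<And>v. v \<in> carrier_vec n \<Longrightarrow> A *\<^sub>v v = 0\<^sub>v n \<Longrightarrow> f \<bullet> v = 0"
  obtains u where "u \<in> carrier_vec n" "A *\<^sub>v u = f"
proof -
  obtain u where u: "u \<in> carrier_vec n" "\<And>i. i < n \<Longrightarrow> col A i \<bullet> (f - A *\<^sub>v u) = 0"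
    "\<And>h. h \<in> carrier_vec n \<Longrightarrow> \<forall>i<n. col A i \<bullet> h = 0 \<Longrightarrow> (A *\<^sub>v u) \<bullet> h = 0"
    using orthogonal_projection_on_columns[OF A f, of n] by auto
  define h where "h = f - A *\<^sub>v u"
  have Au: "A *\<^sub>v u \<in> carrier_vec n"
    using A u by auto
  then have h: "h \<in> carrier_vec n"
    using f by (auto simp: h_def)
  have row: "row A i = col A i" if "i < n" for i
    using A that sym by (metis col_transpose carrier_matD(1))
  have "A *\<^sub>v h = 0\<^sub>v n"
    using A u(2) row by (intro eq_vecI) (auto simp: h_def)
  then have "f \<bullet> h = 0"
    using ker h by simp
  moreover have "(A *\<^sub>v u) \<bullet> h = 0"
    using u(2,3) h by (simp add: h_def)
  ultimately have "h \<bullet> h = 0"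
    using f Au h unfolding h_def by (subst minus_scalar_prod_distrib[of _ n]) auto
  then have "h = 0\<^sub>v n"
    using scalar_prod_self_eq_0_iff[OF h] by simp
  moreover have "f = h + A *\<^sub>v u"
    unfolding h_def using vec_diff_add_cancel[OF f Au] by simp
  ultimately have "A *\<^sub>v u = f"
    using Au by simp
  then show ?thesis
    using that u by blast
qed


section \<open>The pseudo-inverse of a symmetric matrix\<close>

lemma pseudo_inverse_unique:
  assumes X: "is_pseudo_inverse A X" and Y: "is_pseudo_inverse A Y"
  shows "X = Y"
proof -
  define n m where "n = dim_row A" and "m = dim_col A"
  have A: "A \<in> carrier_mat n m" and Xc: "X \<in> carrier_mat m n" and Yc: "Y \<in> carrier_mat m n"
    using X Y by (auto simp: is_pseudo_inverse_def n_def m_def)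
  note X = X[unfolded is_pseudo_inverse_def] and Y = Y[unfolded is_pseudo_inverse_def]
  \<comment> \<open>Penrose's argument: A = A Y A is inserted, and transposing the product of the
    symmetric matrices A Y and A X swaps them, so A X = A X A Y = A Y. Likewise X A = Y A, whence X
    = X A X = Y A Y = Y.\<close>
  have "A * X = transpose_mat (A * Y * A * X)"
    using X Y by simp
  also have "\<dots> = transpose_mat ((A * Y) * (A * X))"
    using assoc_mult_mat[of "A * Y" n n A m X n] A Xc Yc by simp
  also have "\<dots> = transpose_mat (A * X) * transpose_mat (A * Y)"
    using A Xc Yc by (simp add: transpose_mult[of _ n n _ n])
  also have "\<dots> = (A * X * A) * Y"
    using X Y assoc_mult_mat[of "A * X" n n A m Y n] A Xc Yc by simp
  finally have AX: "A * X = A * Y"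
    using X by simp
  have "X * A = transpose_mat (X * (A * Y * A))"
    using X Y by simp
  also have "\<dots> = transpose_mat ((X * A) * (Y * A))"
    using assoc_mult_mat[of X m n A m "Y * A" m] A Xc Yc by simp
  also have "\<dots> = transpose_mat (Y * A) * transpose_mat (X * A)"
    using A Xc Yc by (simp add: transpose_mult[of _ m m _ m])
  also have "\<dots> = Y * (A * X * A)"
    using X Y assoc_mult_mat[of Y m n A m "X * A" m] A Xc Yc by simp
  finally have XA: "X * A = Y * A"
    using X by simp
  have "X = X * (A * X)"
    using X A Xc by simp
  also have "\<dots> = (X * A) * Y"
    unfolding AX using A Xc Yc by simp
  also have "\<dots> = Y"
    unfolding XA using Y by simp
  finally show ?thesis .
qed

text \<open>Symmetry makes the range of \<open>A\<close> that of \<open>A\<^sup>2\<close>, so \<open>A = A\<^sup>2 Y\<close> for some \<open>Y\<close>, and then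
  \<open>Y\<^sup>T A Y\<close> is the pseudo-inverse.\<close>

lemma symmetric_pseudo_inverse:
  fixes A :: "real mat"
  assumes A: "A \<in> carrier_mat n n" and sym: "transpose_mat A = A"
  shows "is_pseudo_inverse A (pseudo_inverse A)"
proof -
  have A2: "A * A \<in> carrier_mat n n"
    using A by simp
  have "\<exists>u. u \<in> carrier_vec n \<and> (A * A) *\<^sub>v u = col A i" if i: "i < n" for i
  proof -
    have c: "col A i \<in> carrier_vec n"
      using A by auto
    \<comment> \<open>The kernel of A * A is that of A, because the squared norm of A v equals the
      scalar product of v with A (A v).\<close>
    have "col A i \<bullet> v = 0" if v: "v \<in> carrier_vec n" "(A * A) *\<^sub>v v = 0\<^sub>v n" for v
    proof -
      have Av: "A *\<^sub>v v \<in> carrier_vec n"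
        using A v by simp
      have "(A *\<^sub>v v) \<bullet> (A *\<^sub>v v) = v \<bullet> (A *\<^sub>v (A *\<^sub>v v))"
        using transpose_vec_mult_scalar[OF A Av v(1)] sym by simp
      also have "\<dots> = 0"
        unfolding assoc_mult_mat_vec[OF A A v(1), symmetric] v(2) using v(1) by simp
      finally have "A *\<^sub>v v = 0\<^sub>v n"
        using scalar_prod_self_eq_0_iff[OF Av] by simp
      then have "row A i \<bullet> v = 0"
        using A i by (metis carrier_matD(1) index_mult_mat_vec index_zero_vec(1))
      then show ?thesis
        using A i sym by (metis col_transpose carrier_matD(1))
    qed
    then show ?thesis
      using symmetric_range[OF A2 _ c] A sym by (metis transpose_mult)
  qed
  then obtain u where u: "u i \<in> carrier_vec n" "(A * A) *\<^sub>v u i = col A i" if "i < n" for i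
    by metis
  define Y where "Y = mat n n (\<lambda>(i, j). u j $ i)"
  have Y: "Y \<in> carrier_mat n n"
    by (simp add: Y_def)
  have "col Y j = u j" if "j < n" for j
    using u(1)[OF that] that by (auto simp: Y_def)
  then have AAY: "A * A * Y = A"
    using A Y u(2) col_mult2[OF A2 Y] by (intro mat_col_eqI) auto
  define Z where "Z = transpose_mat Y"
  have Z: "Z \<in> carrier_mat n n"
    using Y by (simp add: Z_def)
  have "transpose_mat (A * A * Y) = Z * (A * A)"
    unfolding Z_def using A Y sym by (simp add: transpose_mult[of _ n n _ n])
  then have ZAA: "Z * A * A = A"
    using AAY sym A Z by simp
  note assoc = assoc_mult_mat[of _ n n _ n _ n] mult_carrier_mat[of _ n n _ n]
  \<comment> \<open>Since Z is the transpose of Y, this says that A Y is symmetric; all four Penrose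
    conditions rest on it.\<close>
  have AYZA: "A * Y = Z * A"
  proof -
    have "A * Y = (Z * A * A) * Y"
      using ZAA by simp
    also have "\<dots> = Z * (A * A * Y)"
      using A Y Z by (simp add: assoc)
    finally show ?thesis
      using AAY by simp
  qed
  define X where "X = Z * A * Y"
  have X: "X \<in> carrier_mat n n"
    using A Y Z by (simp add: X_def)
  have AX: "A * X = A * Y"
  proof -
    have "A * X = A * (Z * A) * Y"
      unfolding X_def using A Y Z by (simp add: assoc)
    also have "\<dots> = (A * A * Y) * Y"
      unfolding AYZA[symmetric] using A Y by (simp add: assoc)
    finally show ?thesis
      using AAY by simp
  qed
  have XA: "X * A = Z * A"
  proof -
    have "X * A = Z * (A * Y) * A"
      unfolding X_def using A Y Z by (simp add: assoc)
    also have "\<dots> = Z * (Z * A * A)"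
      unfolding AYZA using A Z by (simp add: assoc)
    finally show ?thesis
      using ZAA by simp
  qed
  have AXA: "A * X * A = A"
    unfolding AX AYZA ZAA ..
  have XAX: "X * A * X = X"
  proof -
    have "X * A * X = Z * (A * X)"
      unfolding XA using A Z X by (simp add: assoc)
    also have "\<dots> = X"
      unfolding AX unfolding X_def using A Y Z by (simp add: assoc)
    finally show ?thesis .
  qed
  have "transpose_mat (A * Y) = Z * A"
    using transpose_mult[OF A Y] by (simp add: Z_def sym)
  then have "transpose_mat (A * X) = A * X" "transpose_mat (X * A) = X * A"
    unfolding AX XA AYZA[symmetric] by simp_all
  then have "is_pseudo_inverse A X"
    unfolding is_pseudo_inverse_def using A X AXA XAX by simp
  then have "\<exists>!X. is_pseudo_inverse A X"
    using pseudo_inverse_unique by blast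
  then show ?thesis
    unfolding pseudo_inverse_def by (rule theI')
qed

text \<open>The kernel condition supplies some u with f = A u, to which the Penrose condition A X A
  = A applies.\<close>

lemma pseudo_inverse_solves:
  fixes A :: "real mat"
  assumes A: "A \<in> carrier_mat n n" "transpose_mat A = A" and f: "f \<in> carrier_vec n"
    and ker: "\<And>v. v \<in> carrier_vec n \<Longrightarrow> A *\<^sub>v v = 0\<^sub>v n \<Longrightarrow> f \<bullet> v = 0"
  shows "pseudo_inverse A *\<^sub>v f \<in> carrier_vec n" "A *\<^sub>v (pseudo_inverse A *\<^sub>v f) = f"
proof -
  let ?X = "pseudo_inverse A"
  have X: "?X \<in> carrier_mat n n" "A * ?X * A = A"
    using symmetric_pseudo_inverse[OF A] A by (auto simp: is_pseudo_inverse_def)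
  then show "?X *\<^sub>v f \<in> carrier_vec n"
    using f by simp
  obtain u where u: "u \<in> carrier_vec n" "A *\<^sub>v u = f"
    using symmetric_range[OF A f ker] by blast
  have "f = (A * ?X * A) *\<^sub>v u"
    using u X by simp
  also have "\<dots> = (A * ?X) *\<^sub>v f"
    using assoc_mult_mat_vec[of "A * ?X" n n A n u] A X(1) u by simp
  also have "\<dots> = A *\<^sub>v (?X *\<^sub>v f)"
    using A X(1) f by (intro assoc_mult_mat_vec)
  finally show "A *\<^sub>v (?X *\<^sub>v f) = f" ..
qed

section \<open>Bordered matrices of the compliance constraints, for numerical and for linearized
  stiffness matrices\<close>

definition load_block :: "real \<Rightarrow> real vec \<Rightarrow> real mat \<Rightarrow> real mat" where
  "load_block c f K = four_block_mat (mat 1 1 (\<lambda>_. c)) (- mat_of_row f) (- transpose_mat (mat_of_row f)) K"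

lemma load_block_carrier: "K \<in> carrier_mat n n \<Longrightarrow> load_block c f K \<in> carrier_mat (1 + n) (1 + n)"
  by (auto simp: load_block_def)

lemma load_block_quadratic_form:
  assumes f: "f \<in> carrier_vec n" and K: "K \<in> carrier_mat n n" and v: "v \<in> carrier_vec n"
  shows "(vec 1 (\<lambda>_. t) @\<^sub>v v) \<bullet> (load_block c f K *\<^sub>v (vec 1 (\<lambda>_. t) @\<^sub>v v)) =
    c * t\<^sup>2 - 2 * t * (f \<bullet> v) + v \<bullet> (K *\<^sub>v v)"
proof -
  let ?t = "vec 1 (\<lambda>_. t)"
  have Kv: "K *\<^sub>v v \<in> carrier_vec n"
    using K v by simp
  have "load_block c f K *\<^sub>v (?t @\<^sub>v v) =
    (mat 1 1 (\<lambda>_. c) *\<^sub>v ?t + (- mat_of_row f) *\<^sub>v v) @\<^sub>v ((- transpose_mat (mat_of_row f)) *\<^sub>v ?t + K *\<^sub>v v)"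
    unfolding load_block_def by (rule four_block_mat_mult_vec) (use f K v in auto)
  also have "mat 1 1 (\<lambda>_. c) *\<^sub>v ?t + (- mat_of_row f) *\<^sub>v v = vec 1 (\<lambda>_. c * t - f \<bullet> v)"
    using f v by (intro eq_vecI) (auto simp: scalar_prod_def sum_negf)
  also have "(- transpose_mat (mat_of_row f)) *\<^sub>v ?t + K *\<^sub>v v = (- t) \<cdot>\<^sub>v f + K *\<^sub>v v"
    using f Kv by (intro arg_cong2[of _ _ _ _ "(+)"] eq_vecI) (auto simp: scalar_prod_def)
  finally have "(?t @\<^sub>v v) \<bullet> (load_block c f K *\<^sub>v (?t @\<^sub>v v)) =
    ?t \<bullet> vec 1 (\<lambda>_. c * t - f \<bullet> v) + v \<bullet> ((- t) \<cdot>\<^sub>v f + K *\<^sub>v v)"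
    using scalar_prod_append[of ?t 1 v n "vec 1 (\<lambda>_. c * t - f \<bullet> v)" "(- t) \<cdot>\<^sub>v f + K *\<^sub>v v"] f v Kv by simp
  also have "v \<bullet> ((- t) \<cdot>\<^sub>v f + K *\<^sub>v v) = - t * (f \<bullet> v) + v \<bullet> (K *\<^sub>v v)"
    using f v Kv comm_scalar_prod[OF v f] by (simp add: scalar_prod_add_distrib[of _ n])
  finally show ?thesis
    by (simp add: scalar_prod_def power2_eq_square algebra_simps)
qed

text \<open>With the stiffness term gone, the form at (t, v) is c t^2 - 2 t (f . v). Its minimizer t
  = (f . v) / c gives the value -(f . v)^2 / c, which must be nonnegative.\<close>

lemma load_block_orthogonal:
  assumes f: "f \<in> carrier_vec n" and K: "K \<in> carrier_mat n n" and v: "v \<in> carrier_vec n"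
    and "pos_semidef (load_block c f K)" "v \<bullet> (K *\<^sub>v v) = 0" "c > 0"
  shows "f \<bullet> v = 0"
proof -
  let ?t = "(f \<bullet> v) / c"
  have "0 \<le> (vec 1 (\<lambda>_. ?t) @\<^sub>v v) \<bullet> (load_block c f K *\<^sub>v (vec 1 (\<lambda>_. ?t) @\<^sub>v v))"
    by (rule bspec[OF conjunct2[OF iffD1[OF pos_semidef_iff[OF load_block_carrier[OF K]] assms(4)]]])
       (use v in \<open>intro append_carrier_vec vec_carrier\<close>)
  also have "\<dots> = c * ?t\<^sup>2 - 2 * ?t * (f \<bullet> v)"
    unfolding load_block_quadratic_form[OF f K v] assms(5) by (rule add_0_right)
  also have "\<dots> = - (f \<bullet> v)\<^sup>2 / c"
    using \<open>c > 0\<close> by (simp add: power2_eq_square field_simps)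
  finally show ?thesis
    using \<open>c > 0\<close> by (simp add: field_simps)
qed

text \<open>A Schur complement argument that allows singular K: completing the square with w = v - t
  u turns the form at (t, v) into w . K w + t^2 (c - f . u).\<close>

lemma load_block_pos_semidef:
  assumes K: "K \<in> carrier_mat n n" "pos_semidef K" and u: "u \<in> carrier_vec n"
    and f: "K *\<^sub>v u = f" "f \<bullet> u \<le> c"
  shows "pos_semidef (load_block c f K)"
proof -
  have sym: "transpose_mat K = K"
    using K by (simp add: pos_semidef_def)
  have fc: "f \<in> carrier_vec n"
    using f K u by auto
  have "x \<bullet> (load_block c f K *\<^sub>v x) \<ge> 0" if x: "x \<in> carrier_vec (1 + n)" for x
  proof -
    define t v where "t = x $ 0" and "v = vec_last x n"
    have v: "v \<in> carrier_vec n"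
      by (simp add: v_def)
    have "vec_first x 1 = vec 1 (\<lambda>_. t)"
      by (auto simp: vec_first_def t_def)
    then have x: "x = vec 1 (\<lambda>_. t) @\<^sub>v v"
      using vec_first_last_append[OF x] by (simp add: v_def)
    define w where "w = v - t \<cdot>\<^sub>v u"
    have w: "w \<in> carrier_vec n" and Kv: "K *\<^sub>v v \<in> carrier_vec n"
      using u v K by (auto simp: w_def)
    have Kw: "K *\<^sub>v w = K *\<^sub>v v - t \<cdot>\<^sub>v f"
      unfolding w_def using K u v f by (simp add: mult_minus_distrib_mat_vec[of _ n n] mult_mat_vec[of _ n n])
    have uKv: "u \<bullet> (K *\<^sub>v v) = f \<bullet> v"
      using transpose_vec_mult_scalar[OF K(1) v u] sym f(1) by simp
    have "w \<bullet> (K *\<^sub>v w) = v \<bullet> (K *\<^sub>v v) - t * (v \<bullet> f) - (t * (u \<bullet> (K *\<^sub>v v)) - t * (t * (u \<bullet> f)))"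
      unfolding Kw unfolding w_def using u v fc Kv
      by (simp add: minus_scalar_prod_distrib[of _ n] scalar_prod_minus_distrib[of _ n] algebra_simps)
    also have "\<dots> = v \<bullet> (K *\<^sub>v v) - 2 * t * (f \<bullet> v) + t\<^sup>2 * (f \<bullet> u)"
      using comm_scalar_prod[OF v fc] comm_scalar_prod[OF u fc] uKv by (simp add: power2_eq_square)
    finally have "x \<bullet> (load_block c f K *\<^sub>v x) = w \<bullet> (K *\<^sub>v w) + t\<^sup>2 * (c - f \<bullet> u)"
      unfolding x load_block_quadratic_form[OF fc K(1) v] by (simp add: algebra_simps)
    moreover have "w \<bullet> (K *\<^sub>v w) \<ge> 0"
      using K w by (simp add: pos_semidef_iff[OF K(1)])
    ultimately show ?thesis
      using f(2) by simp
  qed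
  moreover have "load_block c f K $$ (i, j) = load_block c f K $$ (j, i)" if "i < 1 + n" "j < 1 + n" for i j
    using that K fc unfolding pos_semidef_iff[OF K(1)] by (auto simp: load_block_def)
  ultimately show ?thesis
    unfolding pos_semidef_iff[OF load_block_carrier[OF K(1)]] by blast
qed

section \<open>Riesz functionals and moment matrices\<close>

lemma riesz_superset:
  assumes "finite S" "Poly_Mapping.keys p \<subseteq> S"
  shows "riesz y p = (\<Sum>m\<in>S. Poly_Mapping.lookup p m * y m)"
  unfolding riesz_def using assms
  by (intro sum.mono_neutral_left) (auto simp: in_keys_iff)

lemma riesz_0 [simp]: "riesz y 0 = 0"
  by (simp add: riesz_def)

lemma riesz_add: "riesz y (p + q) = riesz y p + riesz y q"
  using Poly_Mapping.keys_add[of p q]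
  by (simp add: riesz_superset[of "Poly_Mapping.keys p \<union> Poly_Mapping.keys q"] lookup_add algebra_simps sum.distrib)

lemma riesz_single: "riesz y (Poly_Mapping.single m c) = c * y m"
  by (simp add: riesz_def)

lemma riesz_sum: "riesz y (sum p S) = (\<Sum>i\<in>S. riesz y (p i))"
  by (induction S rule: infinite_finite_induct) (simp_all add: riesz_add)

lemma mpoly_as_sum:
  fixes p :: mpoly
  assumes "finite S" "Poly_Mapping.keys p \<subseteq> S"
  shows "p = (\<Sum>m\<in>S. Poly_Mapping.single m (Poly_Mapping.lookup p m))"
proof (rule poly_mapping_eqI)
  fix k
  have "(\<Sum>m\<in>S. (Poly_Mapping.lookup p m when m = k)) = Poly_Mapping.lookup p k"
    using assms by (auto simp: when_def sum.delta in_keys_iff)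
  then show "Poly_Mapping.lookup p k = Poly_Mapping.lookup (\<Sum>m\<in>S. Poly_Mapping.single m (Poly_Mapping.lookup p m)) k"
    by (simp add: lookup_sum lookup_single)
qed

text \<open>Supersets of the supports are allowed so that both sums can run over the row indices of
  a moment matrix.\<close>

lemma riesz_mult:
  assumes "finite S" "Poly_Mapping.keys p \<subseteq> S" "finite T" "Poly_Mapping.keys q \<subseteq> T"
  shows "riesz y (p * q) =
    (\<Sum>m\<in>S. \<Sum>k\<in>T. Poly_Mapping.lookup p m * Poly_Mapping.lookup q k * y (m + k))"
proof -
  have "riesz y (p * q) = riesz y ((\<Sum>m\<in>S. Poly_Mapping.single m (Poly_Mapping.lookup p m)) *
      (\<Sum>k\<in>T. Poly_Mapping.single k (Poly_Mapping.lookup q k)))"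
    using mpoly_as_sum[OF assms(1,2)] mpoly_as_sum[OF assms(3,4)] by simp
  then show ?thesis
    by (simp add: sum_product riesz_sum riesz_single mult_single)
qed

lemma riesz_const_mult: "riesz y (mpoly_const c * p) = c * riesz y p"
  by (subst riesz_mult[of "{0}" _ "Poly_Mapping.keys p"])
     (auto simp: mpoly_const_def riesz_def sum_distrib_left mult_ac)

lemma riesz_const: "riesz y (mpoly_const c) = c * y 0"
  by (simp add: mpoly_const_def riesz_single)

lemma mpoly_one: "(1 :: mpoly) = mpoly_const 1"
  by (simp add: mpoly_const_def)

lemma riesz_one: "riesz y 1 = y 0"
  by (simp add: mpoly_one riesz_const)

lemma riesz_uminus: "riesz y (- p) = - riesz y p"
  using riesz_add[of y p "- p"] by simp

lemma riesz_diff: "riesz y (p - q) = riesz y p - riesz y q"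
  using riesz_add[of y p "- q"] by (simp add: riesz_uminus)

lemma mpoly_monom_mult: "mpoly_monom m * mpoly_monom k = mpoly_monom (m + k)"
  by (simp add: mpoly_monom_def mult_single)

lemma riesz_monom: "riesz y (mpoly_monom m) = y m"
  by (simp add: mpoly_monom_def riesz_single)

section \<open>Multiplicative moment vectors\<close>

lemma riesz_hom_mult:
  assumes "\<And>m k. y (m + k) = y m * y k"
  shows "riesz y (p * q) = riesz y p * riesz y q"
  by (subst riesz_mult[of "Poly_Mapping.keys p" _ "Poly_Mapping.keys q"])
     (auto simp: assms riesz_def sum_product mult_ac)

lemma riesz_hom_power:
  assumes "y 0 = 1" "\<And>m k. y (m + k) = y m * y k"
  shows "riesz y (p ^ n) = riesz y p ^ n"
  by (induction n) (simp_all add: riesz_one riesz_hom_mult assms)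

text \<open>The moments of the Dirac measure at \<open>x\<close>; the Riesz functional is then
  evaluation at \<open>x\<close>.\<close>

definition point_moments :: "(nat \<Rightarrow> real) \<Rightarrow> monomial \<Rightarrow> real" where
  "point_moments x m = (\<Prod>i\<in>Poly_Mapping.keys m. x i ^ Poly_Mapping.lookup m i)"

lemma point_moments_superset:
  assumes "finite S" "Poly_Mapping.keys m \<subseteq> S"
  shows "point_moments x m = (\<Prod>i\<in>S. x i ^ Poly_Mapping.lookup m i)"
  unfolding point_moments_def using assms
  by (intro prod.mono_neutral_left) (auto simp: in_keys_iff)

lemma point_moments_0: "point_moments x 0 = 1"
  by (simp add: point_moments_def)

lemma point_moments_add: "point_moments x (m + k) = point_moments x m * point_moments x k"
  using Poly_Mapping.keys_add[of m k]
  by (simp add: point_moments_superset[of "Poly_Mapping.keys m \<union> Poly_Mapping.keys k"]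
      lookup_add power_add prod.distrib)

lemma point_moments_var: "point_moments x (mono_of_var e) = x e"
  by (simp add: point_moments_def mono_of_var_def)

section \<open>Moment matrices and localizing matrices\<close>

lemma monomial_degree_single: "monomial_degree (Poly_Mapping.single e k) = k"
  by (simp add: monomial_degree_def)

text \<open>A monomial is determined by its first n exponents, each at most k. Finiteness is what
  lets \<open>sorted_list_of_set\<close>, which is empty on infinite sets, enumerate the
  monomials.\<close>

lemma finite_monomials_upto: "finite (monomials_upto n k)"
proof (rule finite_imageD)
  let ?f = "\<lambda>m :: monomial. restrict (Poly_Mapping.lookup m) {..<n}"
  have "Poly_Mapping.lookup m i \<le> k" if "m \<in> monomials_upto n k" for m i
  proof (cases "i \<in> Poly_Mapping.keys m")
    case True
    then have "Poly_Mapping.lookup m i \<le> monomial_degree m"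
      unfolding monomial_degree_def by (intro member_le_sum) auto
    then show ?thesis
      using that by (simp add: monomials_upto_def)
  qed (simp add: in_keys_iff)
  then have "?f ` monomials_upto n k \<subseteq> {..<n} \<rightarrow>\<^sub>E {..k}"
    by (intro image_subsetI PiE_I) auto
  then show "finite (?f ` monomials_upto n k)"
    by (rule finite_subset) (intro finite_PiE, auto)
  show "inj_on ?f (monomials_upto n k)"
  proof (rule inj_onI)
    fix m m' assume *: "m \<in> monomials_upto n k" "m' \<in> monomials_upto n k" "?f m = ?f m'"
    show "m = m'"
    proof (rule poly_mapping_eqI)
      fix i
      show "Poly_Mapping.lookup m i = Poly_Mapping.lookup m' i"
      proof (cases "i < n")
        case True
        then show ?thesis
          using fun_cong[OF *(3), of i] by simp
      next
        case False
        then have "i \<notin> Poly_Mapping.keys m" "i \<notin> Poly_Mapping.keys m'"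
          using * by (auto simp: monomials_upto_def)
        then show ?thesis
          by (simp add: in_keys_iff)
      qed
    qed
  qed
qed

lemma zero_in_monomials_upto: "0 \<in> monomials_upto n k"
  by (simp add: monomials_upto_def monomial_degree_def)

lemma single_in_monomials_upto: "e < n \<Longrightarrow> i \<le> k \<Longrightarrow> Poly_Mapping.single e i \<in> monomials_upto n k"
  by (simp add: monomials_upto_def monomial_degree_single)

lemma monomial_vec_index:
  "i < dim_vec (monomial_vec n k) \<Longrightarrow>
    monomial_vec n k $ i = mpoly_monom (sorted_list_of_set (monomials_upto n k) ! i)"
  by (simp add: monomial_vec_def vec_of_list_index)

lemma dim_monomial_vec: "dim_vec (monomial_vec n k) = card (monomials_upto n k)"
  by (simp add: monomial_vec_def)

lemma monomial_vec_obtain_one: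
  obtains l where "l < dim_vec (monomial_vec n k)" "monomial_vec n k $ l = 1"
proof -
  have "0 \<in> set (sorted_list_of_set (monomials_upto n k))"
    by (simp add: finite_monomials_upto zero_in_monomials_upto)
  then obtain l where "l < card (monomials_upto n k)" "sorted_list_of_set (monomials_upto n k) ! l = 0"
    by (metis in_set_conv_nth sorted_list_of_set.length_sorted_key_list_of_set)
  then show ?thesis
    using that[of l] by (simp add: dim_monomial_vec monomial_vec_index mpoly_monom_def)
qed

text \<open>The moment of p^2 is the quadratic form of the moment matrix at the coefficient vector
  of p.\<close>

lemma moment_matrix_square_nonneg:
  assumes "pos_semidef (map_mat (riesz y) (outer_square (monomial_vec n r)))"
    and p: "Poly_Mapping.keys p \<subseteq> monomials_upto n r"
  shows "riesz y (p * p) \<ge> 0"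
proof -
  let ?M = "map_mat (riesz y) (outer_square (monomial_vec n r))"
  let ?L = "sorted_list_of_set (monomials_upto n r)"
  define N where "N = card (monomials_upto n r)"
  define v where "v = vec N (\<lambda>i. Poly_Mapping.lookup p (?L ! i))"
  have M: "?M \<in> carrier_mat N N"
    by (auto simp: outer_square_def dim_monomial_vec N_def)
  have bij: "bij_betw ((!) ?L) {..<N} (monomials_upto n r)"
    by (rule bij_betw_nth) (auto simp: N_def finite_monomials_upto)
  have "0 \<le> v \<bullet> (?M *\<^sub>v v)"
    using assms M by (auto simp: pos_semidef_iff v_def)
  also have "\<dots> = (\<Sum>i<N. \<Sum>j<N. Poly_Mapping.lookup p (?L ! i) * Poly_Mapping.lookup p (?L ! j) * y (?L ! i + ?L ! j))"
    by (subst quadratic_form_sum[OF M])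
       (auto simp: v_def outer_square_def dim_monomial_vec N_def monomial_vec_index mpoly_monom_mult riesz_monom intro!: sum.cong)
  also have "\<dots> = (\<Sum>m\<in>monomials_upto n r. \<Sum>k\<in>monomials_upto n r.
      Poly_Mapping.lookup p m * Poly_Mapping.lookup p k * y (m + k))"
    by (simp add: sum.reindex_bij_betw[OF bij, symmetric])
  also have "\<dots> = riesz y (p * p)"
    by (rule riesz_mult[symmetric]) (use p in \<open>auto simp: finite_monomials_upto\<close>)
  finally show ?thesis .
qed

text \<open>The monomial 1 occurs in the monomial vector for every s, and the diagonal block at its
  position is the moment image of G itself.\<close>

lemma localizing_matrix_restrict:
  assumes "pos_semidef (map_mat (riesz y) (kronecker (outer_square (monomial_vec n s)) G))"
    and G: "G \<in> carrier_mat N N"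
  shows "pos_semidef (map_mat (riesz y) G)"
proof -
  obtain l where l: "l < dim_vec (monomial_vec n s)" "monomial_vec n s $ l = 1"
    using monomial_vec_obtain_one .
  let ?d = "dim_vec (monomial_vec n s)"
  let ?K = "map_mat (riesz y) (kronecker (outer_square (monomial_vec n s)) G)"
  have K: "?K \<in> carrier_mat (?d * N) (?d * N)"
    using G by (auto simp: kronecker_def outer_square_def)
  have lt: "l * N + i < ?d * N" if "i < N" for i
  proof -
    have "l * N + i < Suc l * N"
      using that by simp
    also have "\<dots> \<le> ?d * N"
      using l(1) by (intro mult_le_mono1) simp
    finally show ?thesis .
  qed
  show ?thesis
  proof (rule pos_semidef_submatrix[OF K assms(1), of _ N "\<lambda>i. l * N + i"])
    show "map_mat (riesz y) G $$ (i, j) = ?K $$ (l * N + i, l * N + j)" if "i < N" "j < N" for i j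
      using that G lt[of i] lt[of j] l by (simp add: kronecker_def outer_square_def)
  qed (use G lt in auto)
qed

lemma moment_matrix_hom:
  assumes "\<And>m k. y (m + k) = y m * y k"
  shows "pos_semidef (map_mat (riesz y) (outer_square v))"
proof -
  let ?A = "mat 1 1 (\<lambda>_. 1 :: real)"
  have "map_mat (riesz y) (outer_square v) = 
    mat (dim_vec v) (dim_vec v) (\<lambda>(i, j). ?A $$ (0, 0) * (riesz y (v $ i) * riesz y (v $ j)))"
    by (intro eq_matI) (auto simp: outer_square_def riesz_hom_mult assms)
  then show ?thesis
    using pos_semidef_congruence[of ?A 1 "dim_vec v" "\<lambda>_. 0" "\<lambda>i. riesz y (v $ i)"] pos_semidef_1x1[of 1] by simp
qed

text \<open>By multiplicativity the matrix is the Kronecker product of x x^T with the image of G,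
  where x holds the values of the entries of v. The congruence lemma applies with i mod N as row
  selector and the entry of x at i div N as factor.\<close>

lemma localizing_matrix_hom:
  assumes y: "\<And>m k. y (m + k) = y m * y k"
    and G: "G \<in> carrier_mat N N" "pos_semidef (map_mat (riesz y) G)"
  shows "pos_semidef (map_mat (riesz y) (kronecker (outer_square v) G))"
proof -
  let ?A = "map_mat (riesz y) G"
  let ?d = "dim_vec v * N"
  have pos: "N > 0" if "i < ?d" for i
    using that by (cases N) auto
  have div: "i div N < dim_vec v" if "i < ?d" for i
    using that by (simp add: less_mult_imp_div_less)
  have "map_mat (riesz y) (kronecker (outer_square v) G) = 
    mat ?d ?d (\<lambda>(i, j). ?A $$ (i mod N, j mod N) * (riesz y (v $ (i div N)) * riesz y (v $ (j div N))))"
    using G pos div by (intro eq_matI) (auto simp: outer_square_def kronecker_def riesz_hom_mult y)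
  then show ?thesis
    using pos_semidef_congruence[of ?A N ?d "\<lambda>i. i mod N" "\<lambda>i. riesz y (v $ (i div N))"] G pos by simp
qed

section \<open>Moments of powers of a shifted variable\<close>

lemma mpoly_const_mult: "mpoly_const a * mpoly_const b = mpoly_const (a * b)"
  by (simp add: mpoly_const_def mult_single)

lemma mpoly_const_add: "mpoly_const a + mpoly_const b = mpoly_const (a + b)"
  by (simp add: mpoly_const_def single_add)

lemma mpoly_const_power: "mpoly_const a ^ n = mpoly_const (a ^ n)"
  by (induction n) (simp_all add: mpoly_const_mult mpoly_one)

lemma mpoly_var_power: "mpoly_var e ^ k = mpoly_monom (Poly_Mapping.single e k)"
proof (induction k)
  case 0
  then show ?case by (simp add: mpoly_monom_def)
next
  case (Suc k)
  then show ?case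
    by (simp add: mpoly_var_def mpoly_monom_mult mono_of_var_def single_add[symmetric])
qed

lemma riesz_var_power: "riesz y (mpoly_var e ^ k) = y (Poly_Mapping.single e k)"
  by (simp add: mpoly_var_power riesz_monom)

lemma riesz_var: "riesz y (mpoly_var e) = y (mono_of_var e)"
  by (simp add: mpoly_var_def riesz_monom)

text \<open>The term \<open>y 0\<close> is not replaced by 1: the expansion also serves for
  coefficient functionals, where it is 0.\<close>

lemma riesz_shifted_square:
  "riesz y ((mpoly_var e + 1) ^ 2) = y (Poly_Mapping.single e 2) + 2 * y (mono_of_var e) + y 0"
proof -
  have "(mpoly_var e + 1) ^ 2 = mpoly_var e ^ 2 + mpoly_var e + mpoly_var e + 1"
    by (simp add: power2_eq_square algebra_simps)
  then show ?thesis
    by (simp only: riesz_add riesz_var_power riesz_var riesz_one)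
qed

lemma riesz_shifted_cube:
  "riesz y ((mpoly_var e + 1) ^ 3) = y (Poly_Mapping.single e 3) + 3 * y (Poly_Mapping.single e 2) +
    3 * y (mono_of_var e) + y 0"
proof -
  have "(mpoly_var e + 1) ^ 3 = mpoly_var e ^ 3 + (mpoly_var e ^ 2 + mpoly_var e ^ 2 + mpoly_var e ^ 2) +
    (mpoly_var e + mpoly_var e + mpoly_var e) + 1"
    by (simp add: power2_eq_square power3_eq_cube algebra_simps)
  then show ?thesis
    by (simp only: riesz_add riesz_var_power riesz_var riesz_one)
qed

section \<open>Stiffness matrices\<close>

text \<open>The stiffness matrix with the powers of the design variables replaced by arbitrary numbers;
  for relaxations these numbers are moments.\<close>

definition stiffness_comb :: "design_problem \<Rightarrow> nat \<Rightarrow> (nat \<Rightarrow> nat \<Rightarrow> real) \<Rightarrow> real mat" where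
  "stiffness_comb P j c = mat (n_dof P j) (n_dof P j) (\<lambda>pq.
     Kzero P j $$ pq + (\<Sum>e<n_el P. \<Sum>i=1..3. Kpow P j e i $$ pq * c e i))"

lemma stiffness_comb_carrier [simp]: "stiffness_comb P j c \<in> carrier_mat (n_dof P j) (n_dof P j)"
  by (simp add: stiffness_comb_def)

lemma stiffness_eq_comb: "stiffness P j a = stiffness_comb P j (\<lambda>e i. (a $ e) ^ i)"
  by (simp add: stiffness_def stiffness_gen_def stiffness_comb_def)

lemma stiffness_comb_cong:
  "(\<And>e i. e < n_el P \<Longrightarrow> i \<in> {1..3} \<Longrightarrow> c e i = c' e i) \<Longrightarrow> stiffness_comb P j c = stiffness_comb P j c'"
  unfolding stiffness_comb_def by (auto intro!: sum.cong)

lemma valid_problemD: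
  assumes "valid_problem P"
  shows "n_el P > 0" and "e < n_el P \<Longrightarrow> rho P e > 0" and "e < n_el P \<Longrightarrow> len P e > 0"
    and "j < n_lc P \<Longrightarrow> force P j \<in> carrier_vec (n_dof P j)" and "j < n_lc P \<Longrightarrow> c_bar P j > 0"
    and "j < n_lc P \<Longrightarrow> Kzero P j \<in> carrier_mat (n_dof P j) (n_dof P j)"
    and "j < n_lc P \<Longrightarrow> pos_semidef (Kzero P j)"
    and "j < n_lc P \<Longrightarrow> e < n_el P \<Longrightarrow> i \<in> {1..3} \<Longrightarrow> Kpow P j e i \<in> carrier_mat (n_dof P j) (n_dof P j)"
    and "j < n_lc P \<Longrightarrow> e < n_el P \<Longrightarrow> i \<in> {1..3} \<Longrightarrow> pos_semidef (Kpow P j e i)"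
    and "j < n_lc P \<Longrightarrow> a \<in> carrier_vec (n_el P) \<Longrightarrow> (\<And>e. e < n_el P \<Longrightarrow> a $ e > 0) \<Longrightarrow> pos_def (stiffness P j a)"
  using assms by (auto simp: valid_problem_def)

text \<open>Separating elements and powers allows arguing term by term, with nonnegative forms
  multiplied by arbitrary coefficients.\<close>

lemma stiffness_comb_quadratic_form:
  assumes P: "valid_problem P" "j < n_lc P" and v: "v \<in> carrier_vec (n_dof P j)"
  shows "v \<bullet> (stiffness_comb P j c *\<^sub>v v) = v \<bullet> (Kzero P j *\<^sub>v v) +
    (\<Sum>e<n_el P. \<Sum>i=1..3. c e i * (v \<bullet> (Kpow P j e i *\<^sub>v v)))"
proof -
  let ?n = "n_dof P j"
  let ?w = "\<lambda>p q. v $ p * v $ q"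
  have swap: "(\<Sum>q<?n. \<Sum>e<n_el P. \<Sum>i=1..3. f q e i) = (\<Sum>e<n_el P. \<Sum>i=1..3. \<Sum>q<?n. f q e i)"
    for f :: "nat \<Rightarrow> nat \<Rightarrow> nat \<Rightarrow> real"
    by (rule trans[OF sum.swap sum.cong[OF refl sum.swap]])
  have "v \<bullet> (stiffness_comb P j c *\<^sub>v v) = (\<Sum>p<?n. \<Sum>q<?n. Kzero P j $$ (p, q) * ?w p q) +
    (\<Sum>p<?n. \<Sum>q<?n. \<Sum>e<n_el P. \<Sum>i=1..3. c e i * (Kpow P j e i $$ (p, q) * ?w p q))"
    by (subst quadratic_form_sum[OF _ v])
       (simp_all add: stiffness_comb_def distrib_left distrib_right sum.distrib sum_distrib_left sum_distrib_right mult_ac)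
  also have "(\<Sum>p<?n. \<Sum>q<?n. \<Sum>e<n_el P. \<Sum>i=1..3. c e i * (Kpow P j e i $$ (p, q) * ?w p q)) =
    (\<Sum>e<n_el P. \<Sum>i=1..3. \<Sum>p<?n. \<Sum>q<?n. c e i * (Kpow P j e i $$ (p, q) * ?w p q))"
    by (rule trans[OF sum.cong[OF refl swap] swap])
  also have "\<dots> = (\<Sum>e<n_el P. \<Sum>i=1..3. c e i * (v \<bullet> (Kpow P j e i *\<^sub>v v)))"
    using valid_problemD(8)[OF P] by (intro sum.cong refl) (simp add: quadratic_form_sum[OF _ v] sum_distrib_left)
  also have "(\<Sum>p<?n. \<Sum>q<?n. Kzero P j $$ (p, q) * ?w p q) = v \<bullet> (Kzero P j *\<^sub>v v)"
    using valid_problemD(6)[OF P] by (simp add: quadratic_form_sum[OF _ v])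
  finally show ?thesis .
qed

lemma stiffness_comb_symmetric:
  assumes P: "valid_problem P" "j < n_lc P"
  shows "transpose_mat (stiffness_comb P j c) = stiffness_comb P j c"
proof -
  let ?n = "n_dof P j"
  have "Kzero P j $$ (p, q) = Kzero P j $$ (q, p)" if "p < ?n" "q < ?n" for p q
    using valid_problemD(7)[OF P] that unfolding pos_semidef_iff[OF valid_problemD(6)[OF P]] by blast
  moreover have "Kpow P j e i $$ (p, q) = Kpow P j e i $$ (q, p)"
    if "p < ?n" "q < ?n" "e < n_el P" "i \<in> {1..3}" for p q e i
    using valid_problemD(9)[OF P that(3,4)] that unfolding pos_semidef_iff[OF valid_problemD(8)[OF P that(3,4)]] by blast
  ultimately show ?thesis
    unfolding symmetric_mat_iff[OF stiffness_comb_carrier] by (auto simp: stiffness_comb_def intro!: sum.cong)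
qed

lemma Kpow_quadratic_form_nonneg:
  assumes P: "valid_problem P" "j < n_lc P" and v: "v \<in> carrier_vec (n_dof P j)" and "e < n_el P" "i \<in> {1..3}"
  shows "v \<bullet> (Kpow P j e i *\<^sub>v v) \<ge> 0"
  using valid_problemD(9)[OF P assms(4,5)] v
  unfolding pos_semidef_iff[OF valid_problemD(8)[OF P assms(4,5)]] by blast

lemma Kzero_quadratic_form_nonneg:
  assumes P: "valid_problem P" "j < n_lc P" and v: "v \<in> carrier_vec (n_dof P j)"
  shows "v \<bullet> (Kzero P j *\<^sub>v v) \<ge> 0"
  using valid_problemD(7)[OF P] v unfolding pos_semidef_iff[OF valid_problemD(6)[OF P]] by blast

lemma stiffness_pos_semidef:
  assumes P: "valid_problem P" "j < n_lc P" and a: "\<And>e. e < n_el P \<Longrightarrow> a $ e \<ge> 0"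
  shows "pos_semidef (stiffness P j a)"
proof -
  have "v \<bullet> (stiffness P j a *\<^sub>v v) \<ge> 0" if v: "v \<in> carrier_vec (n_dof P j)" for v
    unfolding stiffness_eq_comb stiffness_comb_quadratic_form[OF P v]
    by (intro add_nonneg_nonneg sum_nonneg mult_nonneg_nonneg zero_le_power
        Kpow_quadratic_form_nonneg[OF P v] Kzero_quadratic_form_nonneg[OF P v] a) auto
  then show ?thesis
    using stiffness_comb_symmetric[OF P] by (simp add: pos_semidef_def stiffness_eq_comb stiffness_comb_def)
qed

lemma feasibleI:
  assumes P: "valid_problem P" and a: "a \<in> carrier_vec (n_el P)" "\<And>e. e < n_el P \<Longrightarrow> a $ e \<ge> 0"
    and ker: "\<And>j v. j < n_lc P \<Longrightarrow> v \<in> carrier_vec (n_dof P j) \<Longrightarrow>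
      stiffness P j a *\<^sub>v v = 0\<^sub>v (n_dof P j) \<Longrightarrow> force P j \<bullet> v = 0"
    and c: "\<And>j. j < n_lc P \<Longrightarrow> compliance P j a \<le> c_bar P j"
  shows "feasible P a"
proof -
  let ?u = "\<lambda>j. pseudo_inverse (stiffness P j a) *\<^sub>v force P j"
  have "?u j \<in> carrier_vec (n_dof P j) \<and> stiffness P j a *\<^sub>v ?u j = force P j" if j: "j < n_lc P" for j
    using pseudo_inverse_solves[OF _ _ valid_problemD(4)[OF P j] ker[OF j]] stiffness_comb_symmetric[OF P j]
    by (simp add: stiffness_eq_comb)
  then show ?thesis
    unfolding feasible_def using a c by (intro conjI exI[of _ ?u]) (auto simp: compliance_def)
qed

section \<open>The scaled problem and its relaxations\<close>

lemma riesz_unscale_power: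
  assumes "e < n_el P"
  shows "riesz y ((unscale_poly P w $ e) ^ i) =
    (1 / 2 * (w / (rho P e * len P e))) ^ i * riesz y ((mpoly_var e + 1) ^ i)"
  using assms by (simp add: unscale_poly_def power_mult_distrib mpoly_const_power mult.commute[of _ "mpoly_const _"] riesz_const_mult
      del: mult_1_left)

lemma scaled_stiffness_carrier [simp]:
  "scaled_stiffness P w j \<in> carrier_mat (n_dof P j) (n_dof P j)"
  by (simp add: scaled_stiffness_def stiffness_gen_def)

lemma riesz_scaled_stiffness_entry:
  assumes "p < n_dof P j" "q < n_dof P j"
  shows "riesz y (scaled_stiffness P w j $$ (p, q)) = Kzero P j $$ (p, q) * y 0 +
    (\<Sum>e<n_el P. \<Sum>i=1..3. Kpow P j e i $$ (p, q) * riesz y ((unscale_poly P w $ e) ^ i))"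
  using assms by (simp add: scaled_stiffness_def stiffness_gen_def riesz_add riesz_sum riesz_const_mult riesz_const)

lemma riesz_scaled_stiffness:
  assumes "y 0 = 1"
  shows "map_mat (riesz y) (scaled_stiffness P w j) = stiffness_comb P j (\<lambda>e i. riesz y ((unscale_poly P w $ e) ^ i))"
  using assms carrier_matD[OF scaled_stiffness_carrier, of P w j]
  by (intro eq_matI) (simp_all add: riesz_scaled_stiffness_entry stiffness_comb_def)

lemma riesz_compliance_block:
  assumes "y 0 = 1" "force P j \<in> carrier_vec (n_dof P j)"
  shows "map_mat (riesz y) (compliance_block P w j) =
    load_block (c_bar P j) (force P j) (stiffness_comb P j (\<lambda>e i. riesz y ((unscale_poly P w $ e) ^ i)))"
proof -
  let ?f = "mat_of_row (map_vec mpoly_const (force P j))"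
  have "map_mat (riesz y) (compliance_block P w j) = four_block_mat (map_mat (riesz y) (mat 1 1 (\<lambda>_. mpoly_const (c_bar P j))))
    (map_mat (riesz y) (- ?f)) (map_mat (riesz y) (- transpose_mat ?f)) (map_mat (riesz y) (scaled_stiffness P w j))"
    unfolding compliance_block_def Let_def
    by (rule map_four_block_mat[where ?nr1.0 = 1 and ?nc1.0 = 1 and ?nr2.0 = "n_dof P j" and ?nc2.0 = "n_dof P j"])
       (use assms in auto)
  also have "map_mat (riesz y) (mat 1 1 (\<lambda>_. mpoly_const (c_bar P j))) = mat 1 1 (\<lambda>_. c_bar P j)"
    using assms(1) by (intro eq_matI) (auto simp: riesz_const)
  also have "map_mat (riesz y) (- ?f) = - mat_of_row (force P j)"
    using assms by (intro eq_matI) (auto simp: riesz_const riesz_uminus)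
  also have "map_mat (riesz y) (- transpose_mat ?f) = - transpose_mat (mat_of_row (force P j))"
    using assms by (intro eq_matI) (auto simp: riesz_const riesz_uminus)
  finally show ?thesis
    by (simp add: load_block_def riesz_scaled_stiffness[of y, OF assms(1)])
qed

section \<open>Blocks and degree of the constraint matrix\<close>

definition constraint_blocks :: "design_problem \<Rightarrow> real \<Rightarrow> mpoly mat list" where
  "constraint_blocks P w = map (compliance_block P w) [0..<n_lc P] @
      map (\<lambda>e. mat 1 1 (\<lambda>_. 1 - mpoly_var e ^ 2)) [0..<n_el P]"

lemma constraint_matrix_blocks: "constraint_matrix P w = diag_block_mat (constraint_blocks P w)"
  by (simp add: constraint_matrix_def constraint_blocks_def)

lemma set_constraint_blocks:
  "set (constraint_blocks P w) = compliance_block P w ` {..<n_lc P} \<union>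
    (\<lambda>e. mat 1 1 (\<lambda>_. 1 - mpoly_var e ^ 2)) ` {..<n_el P}"
  by (auto simp: constraint_blocks_def)

lemma compliance_block_carrier:
  "compliance_block P w j \<in> carrier_mat (1 + n_dof P j) (1 + n_dof P j)"
  unfolding compliance_block_def Let_def
  by (rule four_block_carrier_mat) (use scaled_stiffness_carrier in auto)

lemma constraint_blocks_square: "B \<in> set (constraint_blocks P w) \<Longrightarrow> square_mat B"
  using carrier_matD[OF compliance_block_carrier, of P w] by (auto simp: set_constraint_blocks)

lemma constraint_matrix_carrier:
  "constraint_matrix P w \<in> carrier_mat (dim_row (constraint_matrix P w)) (dim_row (constraint_matrix P w))"
  using diag_block_mat_square[of "constraint_blocks P w"] constraint_blocks_square[of _ P w]
  by (auto simp: constraint_matrix_blocks)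

lemma entry_degree_le_max_degree:
  assumes "B \<in> set As" "\<And>A. A \<in> set As \<Longrightarrow> square_mat A" "i < dim_row B" "j < dim_row B"
    and m: "Poly_Mapping.lookup (B $$ (i, j)) m \<noteq> 0"
  shows "monomial_degree m \<le> max_degree (diag_block_mat As)"
proof -
  let ?D = "diag_block_mat As"
  obtain k where k: "k + dim_row B \<le> dim_row ?D"
    "\<forall>i < dim_row B. \<forall>j < dim_row B. ?D $$ (k + i, k + j) = B $$ (i, j)"
    using diag_block_mat_offset[OF assms(1,2)] by blast
  have "square_mat ?D"
    using diag_block_mat_square assms(2) by blast
  then have "B $$ (i, j) \<in> elements_mat ?D"
    using k assms(3,4) by (intro elements_matI[of ?D "dim_row ?D" "dim_row ?D" "k + i" "k + j"]) (auto intro: carrier_matI)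
  moreover have "finite (elements_mat ?D)"
    by (simp add: elements_mat_def)
  ultimately have "total_degree (B $$ (i, j)) \<le> max_degree ?D"
    unfolding max_degree_def by (intro Max_ge) auto
  moreover have "monomial_degree m \<le> total_degree (B $$ (i, j))"
    unfolding total_degree_def using m by (intro Max_ge) (auto simp: in_keys_iff)
  ultimately show ?thesis
    by simp
qed

text \<open>Extracting a coefficient is a Riesz functional too, so the expansion rules for moments
  also compute coefficients.\<close>

lemma lookup_eq_riesz: "Poly_Mapping.lookup p m = riesz (\<lambda>k. if k = m then 1 else 0) p"
  by (auto simp: riesz_def sum.delta if_distrib in_keys_iff cong: if_cong)

lemma single_monomial_eq_iff:
  "k \<noteq> 0 \<Longrightarrow> Poly_Mapping.single e k = (Poly_Mapping.single e' l :: monomial) \<longleftrightarrow> e = e' \<and> k = l"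
  by (metis lookup_single_eq lookup_single_not_eq)

lemma zero_neq_single: "k \<noteq> 0 \<Longrightarrow> (0 :: monomial) \<noteq> Poly_Mapping.single e k"
  by (metis lookup_single_eq lookup_zero)

lemma max_degree_ge_2:
  assumes "valid_problem P"
  shows "max_degree (constraint_matrix P w) \<ge> 2"
proof -
  obtain e where e: "e < n_el P"
    using valid_problemD(1)[OF assms] by blast
  let ?m = "Poly_Mapping.single e 2 :: monomial"
  let ?B = "mat 1 1 (\<lambda>_. 1 - mpoly_var e ^ 2)"
  have "?B \<in> set (constraint_blocks P w)"
    using e by (auto simp: set_constraint_blocks)
  moreover have "Poly_Mapping.lookup (?B $$ (0, 0)) ?m \<noteq> 0"
    by (simp add: lookup_eq_riesz riesz_diff riesz_one riesz_var_power zero_neq_single)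
  ultimately show ?thesis
    using entry_degree_le_max_degree[of ?B "constraint_blocks P w" 0 0 ?m] constraint_blocks_square[of _ P w]
    by (simp add: constraint_matrix_blocks monomial_degree_single)
qed

text \<open>Among all terms of the entry (p, q), only the cubic term of element e contains x_e^3, so
  its coefficient cannot cancel.\<close>

lemma max_degree_ge_3:
  assumes P: "valid_problem P" "w \<noteq> 0" and j: "j < n_lc P" and e: "e < n_el P"
    and pq: "p < n_dof P j" "q < n_dof P j" and K: "Kpow P j e 3 $$ (p, q) \<noteq> 0"
  shows "max_degree (constraint_matrix P w) \<ge> 3"
proof -
  let ?m = "Poly_Mapping.single e 3 :: monomial"
  let ?y = "\<lambda>k :: monomial. if k = ?m then 1 else 0 :: real"
  let ?B = "compliance_block P w j"
  define s where "s e = 1 / 2 * (w / (rho P e * len P e))" for e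
  have s: "s e \<noteq> 0"
    using valid_problemD(2,3)[OF P(1) e] P(2) by (simp add: s_def)
  have B: "?B \<in> set (constraint_blocks P w)"
    using j by (auto simp: set_constraint_blocks)
  have sum3: "(\<Sum>i=1..3. h i) = h 1 + h 2 + h 3" for h :: "nat \<Rightarrow> real"
    by (simp add: numeral_3_eq_3 numeral_2_eq_2)
  \<comment> \<open>The coefficients of x_e^3 in the powers of x_e' + 1.\<close>
  have pow: "riesz ?y ((mpoly_var e' + 1) ^ 1) = 0" "riesz ?y ((mpoly_var e' + 1) ^ 2) = 0"
    "riesz ?y ((mpoly_var e' + 1) ^ 3) = (if e' = e then 1 else 0)" for e'
    by (simp_all only: power_one_right riesz_shifted_square riesz_shifted_cube riesz_add riesz_var riesz_one mono_of_var_def)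
       (auto simp: single_monomial_eq_iff zero_neq_single)
  have coeff: "(\<Sum>i=1..3. Kpow P j e' i $$ (p, q) * riesz ?y ((unscale_poly P w $ e') ^ i)) =
    (if e' = e then Kpow P j e 3 $$ (p, q) * s e ^ 3 else 0)" if "e' < n_el P" for e'
    unfolding sum3 riesz_unscale_power[OF that] pow by (simp add: s_def)
  have "?B $$ (1 + p, 1 + q) = scaled_stiffness P w j $$ (p, q)"
    using pq carrier_matD[OF scaled_stiffness_carrier, of P w j] by (simp add: compliance_block_def Let_def)
  then have "Poly_Mapping.lookup (?B $$ (1 + p, 1 + q)) ?m = riesz ?y (scaled_stiffness P w j $$ (p, q))"
    by (simp only: lookup_eq_riesz)
  also have "\<dots> = (\<Sum>e'<n_el P. if e' = e then Kpow P j e 3 $$ (p, q) * s e ^ 3 else 0)"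
  proof -
    have "riesz ?y (scaled_stiffness P w j $$ (p, q)) =
      (\<Sum>e'<n_el P. \<Sum>i=1..3. Kpow P j e' i $$ (p, q) * riesz ?y ((unscale_poly P w $ e') ^ i))"
      unfolding riesz_scaled_stiffness_entry[OF pq] by (simp add: zero_neq_single)
    also have "\<dots> = (\<Sum>e'<n_el P. if e' = e then Kpow P j e 3 $$ (p, q) * s e ^ 3 else 0)"
      by (intro sum.cong refl coeff) simp
    finally show ?thesis .
  qed
  also have "\<dots> \<noteq> 0"
    using e K s by (simp add: sum.delta)
  finally show ?thesis
    using entry_degree_le_max_degree[of ?B "constraint_blocks P w" "1 + p" "1 + q" ?m] B constraint_blocks_square[of _ P w]
      pq carrier_matD[OF compliance_block_carrier, of P w j]
    by (simp add: constraint_matrix_blocks monomial_degree_single)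
qed

section \<open>Consequences of feasibility in a relaxation\<close>

lemma relaxation_blocks_pos_semidef:
  assumes "relaxation_feasible P w r y" "B \<in> set (constraint_blocks P w)"
  shows "pos_semidef (map_mat (riesz y) B)"
proof -
  have "pos_semidef (map_mat (riesz y) (constraint_matrix P w))"
    using assms(1) localizing_matrix_restrict[OF _ constraint_matrix_carrier] by (auto simp: relaxation_feasible_def Let_def)
  then have "pos_semidef (diag_block_mat (map (map_mat (riesz y)) (constraint_blocks P w)))"
    by (simp add: constraint_matrix_blocks map_diag_block_mat)
  then show ?thesis
    by (rule pos_semidef_diag_block_matD) (use assms(2) constraint_blocks_square[of _ P w] in auto)
qed

lemma relaxation_first_moments:
  assumes P: "valid_problem P" and r: "max_degree (constraint_matrix P w) \<le> 2 * r"
    and y: "relaxation_feasible P w r y" and e: "e < n_el P"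
  shows "y (mono_of_var e) \<ge> -1"
    and "y (mono_of_var e) = -1 \<Longrightarrow> riesz y ((mpoly_var e + 1) ^ 2) = 0"
    and "y (mono_of_var e) = -1 \<Longrightarrow> r \<ge> 2 \<Longrightarrow> riesz y ((mpoly_var e + 1) ^ 3) = 0"
proof -
  let ?n = "n_el P"
  let ?x = "mpoly_var e"
  have y0: "y 0 = 1" and M: "pos_semidef (map_mat (riesz y) (outer_square (monomial_vec ?n r)))"
    using y by (auto simp: relaxation_feasible_def Let_def)
  \<comment> \<open>This brings x_e + 1 within the degree bound of the moment matrix.\<close>
  have "r \<ge> 1"
    using max_degree_ge_2[OF P, of w] r by linarith
  have x: "?x = Poly_Mapping.single (Poly_Mapping.single e 1) 1"
    by (simp add: mpoly_var_def mpoly_monom_def mono_of_var_def)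
  have "Poly_Mapping.keys (?x + 1) \<subseteq> Poly_Mapping.keys ?x \<union> Poly_Mapping.keys (1 :: mpoly)"
    by (rule Poly_Mapping.keys_add)
  also have "\<dots> \<subseteq> monomials_upto ?n r"
    unfolding x using e \<open>r \<ge> 1\<close> by (auto simp: zero_in_monomials_upto intro: single_in_monomials_upto)
  finally have square: "riesz y ((?x + 1) ^ 2) \<ge> 0"
    using moment_matrix_square_nonneg[OF M] by (simp add: power2_eq_square)
  have "pos_semidef (map_mat (riesz y) (mat 1 1 (\<lambda>_. 1 - ?x ^ 2)))"
    by (rule relaxation_blocks_pos_semidef[OF y]) (use e in \<open>auto simp: set_constraint_blocks\<close>)
  moreover have "map_mat (riesz y) (mat 1 1 (\<lambda>_. 1 - ?x ^ 2)) = mat 1 1 (\<lambda>_. riesz y (1 - ?x ^ 2))"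
    by (intro eq_matI) auto
  ultimately have "riesz y (1 - ?x ^ 2) \<ge> 0"
    by (simp only: pos_semidef_1x1)
  then have bound: "y (Poly_Mapping.single e 2) \<le> 1"
    by (simp add: riesz_diff riesz_one riesz_var_power y0)
  show ge: "y (mono_of_var e) \<ge> -1"
    using square bound unfolding riesz_shifted_square y0 by linarith
  assume eq: "y (mono_of_var e) = -1"
  show zero: "riesz y ((?x + 1) ^ 2) = 0"
    using square bound eq unfolding riesz_shifted_square y0 by linarith
  assume "r \<ge> 2"
  define T F where "T = riesz y ((?x + 1) ^ 3)" and "F = riesz y ((?x + 1) ^ 4)"
  \<comment> \<open>The moment of the square of \<open>\<alpha> (x + 1) + (x + 1)\<^sup>2\<close> is affine in \<open>\<alpha>\<close>, so nonnegativity kills its slope.\<close>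
  have "0 \<le> 2 * \<alpha> * T + F" for \<alpha>
  proof -
    define p where "p = mpoly_const \<alpha> * (?x + 1) + (?x + 1) ^ 2"
    \<comment> \<open>The expanded form exhibits the support of \<open>p\<close>, whose degree is
      within the bound once r >= 2.\<close>
    have "p = ?x ^ 2 + (mpoly_const (\<alpha> + 2) * ?x + mpoly_const (\<alpha> + 1))"
    proof -
      have "mpoly_const (\<alpha> + 2) = mpoly_const \<alpha> + 1 + 1" "mpoly_const (\<alpha> + 1) = mpoly_const \<alpha> + 1"
        by (simp_all add: mpoly_one mpoly_const_add add.commute)
      then show ?thesis
        by (simp add: p_def power2_eq_square algebra_simps)
    qed
    also have "\<dots> = Poly_Mapping.single (Poly_Mapping.single e 2) 1 +
        (Poly_Mapping.single (Poly_Mapping.single e 1) (\<alpha> + 2) + Poly_Mapping.single 0 (\<alpha> + 1))"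
      unfolding mpoly_var_power unfolding mpoly_monom_def x by (simp add: mpoly_const_def mult_single)
    finally have "p = \<dots>" .
    then have "Poly_Mapping.keys p \<subseteq> {Poly_Mapping.single e 2, Poly_Mapping.single e 1, 0}"
      by (auto dest!: subsetD[OF Poly_Mapping.keys_add] split: if_splits)
    also have "\<dots> \<subseteq> monomials_upto ?n r"
      using e \<open>r \<ge> 2\<close> by (auto simp: zero_in_monomials_upto intro: single_in_monomials_upto)
    finally have "0 \<le> riesz y (p * p)"
      by (rule moment_matrix_square_nonneg[OF M])
    also have "p * p = mpoly_const (\<alpha> * \<alpha>) * (?x + 1) ^ 2 + mpoly_const (2 * \<alpha>) * (?x + 1) ^ 3 + (?x + 1) ^ 4"
    proof -
      define z where "z = ?x + 1"
      have "mpoly_const (2 * \<alpha>) = mpoly_const \<alpha> + mpoly_const \<alpha>" "mpoly_const (\<alpha> * \<alpha>) = mpoly_const \<alpha> * mpoly_const \<alpha>"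
        by (simp_all add: mpoly_const_add mpoly_const_mult)
      then show ?thesis
        unfolding p_def z_def[symmetric] by (simp add: power2_eq_square power3_eq_cube power4_eq_xxxx algebra_simps)
    qed
    \<comment> \<open>The term quadratic in \<alpha> drops out by \<open>zero\<close>.\<close>
    also have "riesz y \<dots> = 2 * \<alpha> * T + F"
      by (simp only: riesz_add riesz_const_mult zero T_def F_def)
    finally show ?thesis .
  qed
  \<comment> \<open>If T were nonzero, this \<alpha> would make the affine expression equal to
    -1.\<close>
  from this[of "- (F + 1) / (2 * T)"] show "riesz y ((?x + 1) ^ 3) = 0"
    unfolding T_def[symmetric] by (cases "T = 0") (auto simp: field_simps)
qed

lemma moment_design_nonneg:
  assumes "valid_problem P" "w > 0" "max_degree (constraint_matrix P w) \<le> 2 * r"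
    and "relaxation_feasible P w r y" "e < n_el P"
  shows "moment_design P w y $ e \<ge> 0"
  using relaxation_first_moments(1)[OF assms(1,3,4,5)] valid_problemD(2,3)[OF assms(1,5)] assms(2,5)
  by (simp add: moment_design_def)

text \<open>The stiffness matrix of the moment design and the linearized one are compared only term
  by term. Both forms at \<open>v\<close> are combinations of the same nonnegative numbers
  \<open>?q e i\<close>, besides the common constant term. If the first form vanishes, then for each
  e and i either \<open>?q e i\<close> is zero or cross section e is, and in the second case the
  moment multiplying \<open>?q e i\<close> vanishes. The sign of a third-order moment therefore
  never matters.\<close>

lemma moment_design_kernel_orthogonal:
  assumes P: "valid_problem P" and w: "w > 0" and r: "max_degree (constraint_matrix P w) \<le> 2 * r"
    and y: "relaxation_feasible P w r y" and j: "j < n_lc P" and \<delta>: "\<delta> > 0"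
    and v: "v \<in> carrier_vec (n_dof P j)"
    and ker: "stiffness P j (\<delta> \<cdot>\<^sub>v moment_design P w y) *\<^sub>v v = 0\<^sub>v (n_dof P j)"
  shows "force P j \<bullet> v = 0"
proof -
  let ?a = "moment_design P w y"
  let ?L = "\<lambda>e i. riesz y ((unscale_poly P w $ e) ^ i)"
  let ?q = "\<lambda>e i. v \<bullet> (Kpow P j e i *\<^sub>v v)"
  have y0: "y 0 = 1"
    using y by (simp add: relaxation_feasible_def Let_def)
  have dim: "dim_vec ?a = n_el P"
    by (simp add: moment_design_def)
  have a: "?a $ e \<ge> 0" if "e < n_el P" for e
    by (rule moment_design_nonneg[OF P w r y that])
  note K0 = Kzero_quadratic_form_nonneg[OF P j v] and K = Kpow_quadratic_form_nonneg[OF P j v]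
  have nonneg: "((\<delta> \<cdot>\<^sub>v ?a) $ e) ^ i * ?q e i \<ge> 0" if "e < n_el P" "i \<in> {1..3}" for e i
    using a[OF that(1)] K[OF that] \<delta> dim that(1) by simp
  have "v \<bullet> (stiffness P j (\<delta> \<cdot>\<^sub>v ?a) *\<^sub>v v) = 0"
    using ker v by simp
  then have sum0: "v \<bullet> (Kzero P j *\<^sub>v v) + (\<Sum>e<n_el P. \<Sum>i=1..3. ((\<delta> \<cdot>\<^sub>v ?a) $ e) ^ i * ?q e i) = 0"
    unfolding stiffness_eq_comb stiffness_comb_quadratic_form[OF P j v] .
  have "(\<Sum>e<n_el P. \<Sum>i=1..3. ((\<delta> \<cdot>\<^sub>v ?a) $ e) ^ i * ?q e i) \<ge> 0"
    by (intro sum_nonneg nonneg) auto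
  with K0 sum0 have K0z: "v \<bullet> (Kzero P j *\<^sub>v v) = 0"
    and "(\<Sum>e<n_el P. \<Sum>i=1..3. ((\<delta> \<cdot>\<^sub>v ?a) $ e) ^ i * ?q e i) = 0"
    by linarith+
  then have "\<forall>e\<in>{..<n_el P}. (\<Sum>i=1..3. ((\<delta> \<cdot>\<^sub>v ?a) $ e) ^ i * ?q e i) = 0"
    by (subst (asm) sum_nonneg_eq_0_iff) (auto intro!: sum_nonneg nonneg)
  then have prod0: "((\<delta> \<cdot>\<^sub>v ?a) $ e) ^ i * ?q e i = 0" if "e < n_el P" "i \<in> {1..3}" for e i
    using that nonneg[OF that(1)] sum_nonneg_eq_0_iff[of "{1..3}" "\<lambda>i. ((\<delta> \<cdot>\<^sub>v ?a) $ e) ^ i * ?q e i"] by blast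
  have "?L e i * ?q e i = 0" if ei: "e < n_el P" "i \<in> {1..3}" for e i
  proof (cases "?q e i = 0")
    case False
    then have "?a $ e = 0"
      using prod0[OF ei] \<delta> dim ei by auto
    then have eq: "y (mono_of_var e) = -1"
      using w valid_problemD(2,3)[OF P ei(1)] ei(1) by (simp add: moment_design_def)
    note mom = relaxation_first_moments[OF P r y ei(1)]
    have "riesz y ((mpoly_var e + 1) ^ i) = 0"
    proof -
      consider "i = 1" | "i = 2" | "i = 3"
        using ei(2) by (auto simp: numeral_3_eq_3 le_Suc_eq)
      then show ?thesis
      proof cases
        case 1
        then show ?thesis
          using eq y0 by (simp add: riesz_add riesz_var riesz_one)
      next
        case 2
        then show ?thesis
          using mom(2) eq by simp
      next
        case 3
        have Kc: "Kpow P j e 3 \<in> carrier_mat (n_dof P j) (n_dof P j)"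
          using valid_problemD(8)[OF P j ei] 3 by simp
        \<comment> \<open>A nonzero form of the cubic matrix at \<open>v\<close> needs a nonzero
          entry, which makes the cube occur in the constraint matrix.\<close>
        obtain p q where "p < n_dof P j" "q < n_dof P j" "Kpow P j e 3 $$ (p, q) \<noteq> 0"
        proof (rule ccontr)
          note ex = that
          assume neg: "\<not> thesis"
          have "Kpow P j e 3 $$ (p, q) = 0" if "p < n_dof P j" "q < n_dof P j" for p q
            using ex[OF that] neg by blast
          then have "?q e 3 = 0"
            by (subst quadratic_form_sum[OF Kc v]) (auto intro!: sum.neutral)
          then show False
            using False 3 by simp
        qed
        then have "max_degree (constraint_matrix P w) \<ge> 3"
          using max_degree_ge_3[OF P _ j ei(1)] w by auto
        then have "r \<ge> 2"
          using r by linarith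
        then show ?thesis
          using mom(3) eq 3 by simp
      qed
    qed
    then show ?thesis
      using riesz_unscale_power[OF ei(1)] by simp
  qed simp
  then have "v \<bullet> (stiffness_comb P j ?L *\<^sub>v v) = 0"
    unfolding stiffness_comb_quadratic_form[OF P j v] K0z by (auto intro!: sum.neutral)
  moreover have "pos_semidef (load_block (c_bar P j) (force P j) (stiffness_comb P j ?L))"
    using relaxation_blocks_pos_semidef[OF y, of "compliance_block P w j"] j
      riesz_compliance_block[of y, OF y0 valid_problemD(4)[OF P j]] by (auto simp: set_constraint_blocks)
  ultimately show ?thesis
    using load_block_orthogonal[OF valid_problemD(4)[OF P j] stiffness_comb_carrier v] valid_problemD(5)[OF P j] by blast
qed

section \<open>Weights and the lower bound from the relaxation\<close>

lemma riesz_scaled_objective: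
  assumes "valid_problem P" "y 0 = 1"
  shows "riesz y (scaled_objective P w) = 0.5 * w * (real (n_el P) + (\<Sum>e<n_el P. y (mono_of_var e)))"
proof -
  have "(of_nat n :: mpoly) = mpoly_const (real n)" for n
    by (induction n) (simp_all add: mpoly_one mpoly_const_add, simp_all add: mpoly_const_def)
  then show ?thesis
    using assms(2) by (simp add: scaled_objective_def riesz_const_mult riesz_add riesz_sum riesz_const riesz_var)
qed

text \<open>The objective is affine, so only first-order moments enter, and the factor
  \<open>rho P e * len P e\<close> cancels against the scaling.\<close>

lemma weight_moment_design:
  assumes "valid_problem P" "y 0 = 1"
  shows "weight P (moment_design P w y) = riesz y (scaled_objective P w)"
proof -
  have "rho P e * len P e * moment_design P w y $ e = 0.5 * w * (1 + y (mono_of_var e))" if "e < n_el P" for e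
    using valid_problemD(2,3)[OF assms(1) that] that by (simp add: moment_design_def field_simps)
  then have "weight P (moment_design P w y) = (\<Sum>e<n_el P. 0.5 * w * (1 + y (mono_of_var e)))"
    unfolding weight_def by (intro sum.cong) auto
  also have "\<dots> = 0.5 * w * (\<Sum>e<n_el P. 1 + y (mono_of_var e))"
    by (simp only: sum_distrib_left)
  finally show ?thesis
    by (simp add: riesz_scaled_objective[where y = y, OF assms] sum.distrib)
qed

lemma weight_smult:
  assumes "a \<in> carrier_vec (n_el P)"
  shows "weight P (\<delta> \<cdot>\<^sub>v a) = \<delta> * weight P a"
  unfolding weight_def sum_distrib_left using assms by (intro sum.cong) auto

text \<open>The weight bound puts the scaled design into the box [-1, 1], so evaluation at it
  satisfies the constraints of every relaxation.\<close>

lemma feasible_point_relaxation: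
  assumes P: "valid_problem P" and w: "w > 0" and b: "feasible P b" "weight P b \<le> w"
  obtains y where "relaxation_feasible P w r y" "riesz y (scaled_objective P w) = weight P b"
proof -
  define s where "s e = 1 / 2 * (w / (rho P e * len P e))" for e
  \<comment> \<open>The point inverts the substitution a_e = (x_e + 1) \<open>s e\<close>.\<close>
  define y where "y = point_moments (\<lambda>e. b $ e / s e - 1)"
  have y0: "y 0 = 1" and hom: "y (m + k) = y m * y k" for m k
    by (simp_all add: y_def point_moments_0 point_moments_add)
  have s: "s e > 0" if "e < n_el P" for e
    using valid_problemD(2,3)[OF P that] w by (simp add: s_def)
  have bc: "b \<in> carrier_vec (n_el P)" and b0: "\<And>e. e < n_el P \<Longrightarrow> b $ e \<ge> 0"
    using b by (auto simp: feasible_def)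
  have y1: "y (mono_of_var e) = b $ e / s e - 1" for e
    by (simp add: y_def point_moments_var)
  have "moment_design P w y $ e = (y (mono_of_var e) + 1) * s e" if "e < n_el P" for e
    using that by (simp add: moment_design_def s_def)
  then have "moment_design P w y $ e = b $ e" if "e < n_el P" for e
    using s[OF that] that by (simp add: y1)
  then have des: "moment_design P w y = b"
    using bc by (intro eq_vecI) (auto simp: moment_design_def)
  have pow: "riesz y ((unscale_poly P w $ e) ^ i) = (b $ e) ^ i" if "e < n_el P" for e i
    using s[OF that] unfolding riesz_unscale_power[OF that] s_def[symmetric] riesz_hom_power[of y, OF y0 hom]
    by (simp add: riesz_add riesz_var riesz_one y0 y1 power_divide)
  have "pos_semidef (map_mat (riesz y) B)" if "B \<in> set (constraint_blocks P w)" for B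
    using that unfolding set_constraint_blocks
  proof (elim UnE imageE)
    fix j assume B: "B = compliance_block P w j" and "j \<in> {..<n_lc P}"
    then have j: "j < n_lc P" by simp
    obtain u where u: "u \<in> carrier_vec (n_dof P j)" "stiffness P j b *\<^sub>v u = force P j" "force P j \<bullet> u \<le> c_bar P j"
      using b(1) j unfolding feasible_def by force
    have "stiffness_comb P j (\<lambda>e i. riesz y ((unscale_poly P w $ e) ^ i)) = stiffness P j b"
      unfolding stiffness_eq_comb by (intro stiffness_comb_cong pow)
    then have "map_mat (riesz y) B = load_block (c_bar P j) (force P j) (stiffness P j b)"
      unfolding B riesz_compliance_block[of y, OF y0 valid_problemD(4)[OF P j]] by simp
    moreover have "stiffness P j b \<in> carrier_mat (n_dof P j) (n_dof P j)"
      by (simp add: stiffness_eq_comb)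
    ultimately show ?thesis
      using load_block_pos_semidef[OF _ stiffness_pos_semidef[OF P j] u] b0 by simp
  next
    fix e assume B: "B = mat 1 1 (\<lambda>_. 1 - mpoly_var e ^ 2)" and "e \<in> {..<n_el P}"
    then have e: "e < n_el P" by simp
    \<comment> \<open>A single summand of the weight is at most the whole, all summands being
      nonnegative.\<close>
    have "rho P e * len P e * b $ e \<le> weight P b"
      unfolding weight_def using valid_problemD(2,3)[OF P] b0 e
      by (intro member_le_sum) (auto simp: less_imp_le)
    then have "b $ e \<le> 2 * s e"
      using b(2) valid_problemD(2,3)[OF P e] by (simp add: s_def field_simps)
    then have "\<bar>b $ e / s e - 1\<bar> \<le> 1"
      using s[OF e] b0[OF e] by (simp add: abs_le_iff field_simps)
    then have "(b $ e / s e - 1)\<^sup>2 \<le> 1"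
      by (simp add: abs_square_le_1)
    moreover have "map_mat (riesz y) B = mat 1 1 (\<lambda>_. 1 - (b $ e / s e - 1)\<^sup>2)"
      unfolding B by (intro eq_matI) (auto simp: riesz_diff riesz_one riesz_hom_power[of y, OF y0 hom] riesz_var y0 y1)
    ultimately show ?thesis
      by (simp only: pos_semidef_1x1)
  qed
  then have "pos_semidef (map_mat (riesz y) (constraint_matrix P w))"
    unfolding constraint_matrix_blocks map_diag_block_mat[of "riesz y", OF riesz_0]
    by (intro pos_semidef_diag_block_mat) auto
  then have "relaxation_feasible P w r y"
    using moment_matrix_hom[of y] localizing_matrix_hom[of y, OF _ constraint_matrix_carrier] hom y0
    by (simp add: relaxation_feasible_def Let_def)
  moreover have "riesz y (scaled_objective P w) = weight P b"
    using weight_moment_design[where y = y and w = w, OF P y0] unfolding des by (rule sym)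
  ultimately show ?thesis
    by (rule that)
qed

theorem proposition6:
  fixes P :: design_problem
    and a_hat a_tilde :: "real vec"
    and \<delta>_hat w_bar \<delta>_star \<epsilon> :: real
    and r :: nat
    and y :: "monomial \<Rightarrow> real"
  assumes "valid_problem P"
    and "a_hat \<in> carrier_vec (n_el P)" and "\<forall>e < n_el P. a_hat $ e > 0"
    and "univariate_solution P a_hat \<delta>_hat"
    and "w_bar = \<delta>_hat * (\<Sum>e<n_el P. rho P e * len P e * a_hat $ e)"
    and "2 * r \<ge> max_degree (constraint_matrix P w_bar)"
    and "relaxation_solution P w_bar r y"
    and "a_tilde = moment_design P w_bar y"
    and "\<forall>j < n_lc P. (INF \<delta> \<in> {0<..}. compliance P j (\<delta> \<cdot>\<^sub>v a_tilde)) < c_bar P j"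
    and "solvable P"
    and "univariate_solution P a_tilde \<delta>_star"
    and "(\<delta>_star - 1) * 0.5 * w_bar * (real (n_el P) + (\<Sum>e<n_el P. y (mono_of_var e))) \<le> \<epsilon>"
  shows "globally_eps_optimal P \<epsilon> (\<delta>_star \<cdot>\<^sub>v a_tilde)"
proof -
  note P = assms(1) and a_tilde = assms(8)
  have \<delta>_hat: "\<delta>_hat > 0" "\<And>j. j < n_lc P \<Longrightarrow> compliance P j (\<delta>_hat \<cdot>\<^sub>v a_hat) \<le> c_bar P j"
    using assms(4) by (auto simp: univariate_solution_def univariate_feasible_def)
  have \<delta>_star: "\<delta>_star > 0" "\<And>j. j < n_lc P \<Longrightarrow> compliance P j (\<delta>_star \<cdot>\<^sub>v a_tilde) \<le> c_bar P j"
    using assms(11) by (auto simp: univariate_solution_def univariate_feasible_def)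
  have "0 < (\<Sum>e<n_el P. rho P e * len P e * a_hat $ e)"
    using valid_problemD(1-3)[OF P] assms(3) by (intro sum_pos) auto
  then have w: "w_bar > 0"
    using \<delta>_hat(1) assms(5) by simp
  have y: "relaxation_feasible P w_bar r y"
    and opt: "\<And>z. relaxation_feasible P w_bar r z \<Longrightarrow>
      riesz y (scaled_objective P w_bar) \<le> riesz z (scaled_objective P w_bar)"
    using assms(7) by (auto simp: relaxation_solution_def)
  have y0: "y 0 = 1"
    using y by (simp add: relaxation_feasible_def Let_def)
  have c: "a_tilde \<in> carrier_vec (n_el P)"
    by (simp add: a_tilde moment_design_def)
  have "weight P (\<delta>_hat \<cdot>\<^sub>v a_hat) = w_bar"
    using assms(2,5) by (simp add: weight_smult) (simp add: weight_def)
  \<comment> \<open>This design is positive, so its stiffness matrices have trivial kernel. It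
    replaces competitors heavier than \<open>w_bar\<close> and shows that the infimum is over a
    nonempty set.\<close>
  have hat: "feasible P (\<delta>_hat \<cdot>\<^sub>v a_hat)"
  proof (rule feasibleI[OF P _ _ _ \<delta>_hat(2)])
    fix j v
    assume j: "j < n_lc P" and v: "v \<in> carrier_vec (n_dof P j)"
      and ker: "stiffness P j (\<delta>_hat \<cdot>\<^sub>v a_hat) *\<^sub>v v = 0\<^sub>v (n_dof P j)"
    have "pos_def (stiffness P j (\<delta>_hat \<cdot>\<^sub>v a_hat))"
      using assms(2,3) \<delta>_hat(1) by (intro valid_problemD(10)[OF P j]) auto
    moreover have "dim_row (stiffness P j (\<delta>_hat \<cdot>\<^sub>v a_hat)) = n_dof P j"
      by (simp add: stiffness_eq_comb stiffness_comb_def)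
    moreover have "v \<bullet> (stiffness P j (\<delta>_hat \<cdot>\<^sub>v a_hat) *\<^sub>v v) = 0"
      using ker v by simp
    ultimately have "v = 0\<^sub>v (n_dof P j)"
      using v unfolding pos_def_def by force
    then show "force P j \<bullet> v = 0"
      using valid_problemD(4)[OF P j] by simp
  qed (use assms(2,3) \<delta>_hat(1) in \<open>auto simp: less_imp_le\<close>)
  have star: "feasible P (\<delta>_star \<cdot>\<^sub>v a_tilde)"
  proof (rule feasibleI[OF P _ _ _ \<delta>_star(2)])
    fix j v
    assume "j < n_lc P" "v \<in> carrier_vec (n_dof P j)"
      "stiffness P j (\<delta>_star \<cdot>\<^sub>v a_tilde) *\<^sub>v v = 0\<^sub>v (n_dof P j)"
    then show "force P j \<bullet> v = 0"
      using moment_design_kernel_orthogonal[OF P w assms(6) y _ \<delta>_star(1)] a_tilde by blast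
  qed (use c moment_design_nonneg[OF P w assms(6) y] \<delta>_star(1) a_tilde in auto)
  have lower: "weight P a_tilde \<le> weight P b" if b: "feasible P b" for b
  proof -
    \<comment> \<open>A heavy \<open>b\<close> may leave the scaled box; then \<open>b'\<close> is
      the reference design, whose weight is exactly \<open>w_bar\<close>.\<close>
    obtain b' where b': "feasible P b'" "weight P b' \<le> w_bar" "weight P b' \<le> weight P b"
      using hat b \<open>weight P (\<delta>_hat \<cdot>\<^sub>v a_hat) = w_bar\<close> by (metis linear order_refl)
    obtain z where "relaxation_feasible P w_bar r z" "riesz z (scaled_objective P w_bar) = weight P b'"
      using feasible_point_relaxation[OF P w b'(1,2)] .
    then show ?thesis
      using opt b'(3) unfolding a_tilde weight_moment_design[where y = y, OF P y0] by force
  qed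
  have "weight P a_tilde \<le> (INF b \<in> Collect (feasible P). weight P b)"
    using hat lower by (intro cINF_greatest) auto
  moreover have "weight P (\<delta>_star \<cdot>\<^sub>v a_tilde) =
    weight P a_tilde + (\<delta>_star - 1) * 0.5 * w_bar * (real (n_el P) + (\<Sum>e<n_el P. y (mono_of_var e)))"
  proof -
    have "weight P a_tilde = 0.5 * w_bar * (real (n_el P) + (\<Sum>e<n_el P. y (mono_of_var e)))"
      unfolding a_tilde weight_moment_design[where y = y, OF P y0] by (rule riesz_scaled_objective[where y = y, OF P y0])
    then show ?thesis
      unfolding weight_smult[OF c] by (simp add: field_simps)
  qed
  ultimately show ?thesis
    using star assms(12) unfolding globally_eps_optimal_def by linarith
qed

end
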